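(* Let $\psi$ be an entire function and let $\varphi(z)=az+b$, where $a,b\in\mathbb{C}$ and $|a|=1$. Suppose that the weighted composition operator $C_{\psi,\varphi}$ is bounded on the Fock space $\mathcal{F}^2$. Then: (a) If $a\neq 1$ and $a$ is a primitive root of $1$ of order $n$, then $W(C_{\psi,\varphi})=\psi(0)e^{\frac{a|b|^{2}}{a-1}}P$, where $P$ is the union of the polygon with $n$ sides and vertices at $1,a,\dots,a^{n-1}$ and its interior region. (b) If $a$ is not a root of $1$, then $W(C_{\psi,\varphi})=\psi(0)e^{\frac{a|b|^{2}}{a-1}}\mathbb{D}\cup\left\{\psi(0)e^{\frac{a|b|^{2}}{a-1}}a^{m}:m\geq 0\right\}$. (c) If $a=1$, then $W(C_{\psi,\varphi})=\psi(0)e^{\frac{|b|^{2}}{2}}\mathbb{D}$.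
   Context: The Fock space $\mathcal{F}^2$ is the Hilbert space of all entire functions $f:\mathbb{C}\to\mathbb{C}$ that are square integrable with respect to $d\mu(z)=\pi^{-1}e^{-|z|^2}\,dA(z)$, where $dA$ is Lebesgue measure on $\mathbb{C}$, with inner product $\langle f,g\rangle=\int_{\mathbb{C}}f\overline{g}\,d\mu$. For entire functions $\psi,\varphi$, the weighted composition operator is $C_{\psi,\varphi}h=\psi\cdot(h\circ\varphi)$. The numerical range of a bounded operator $T$ on a Hilbert space is $W(T)=\{\langle Tf,f\rangle:\|f\|=1\}$. $\mathbb{D}$ is the open unit disk in $\mathbb{C}$; for $c\in\mathbb{C}$ and $S\subseteq\mathbb{C}$, $cS=\{cs:s\in S\}$. "Root of $1$" means root of unity. The set $P$ in (a) is the convex hull of $\{1,a,\dots,a^{n-1}\}$; for $n=2$ it is the segment $[-1,1]$.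
   Formalization: Part (c) is stated only for b ≠ 0 or ψ(0) = 0: if a = 1, b = 0 and ψ(0) ≠ 0, the operator is ψ(0) times the identity, so its numerical range is {ψ(0)} and not the open disk ψ(0)𝔻. *)

theory Defs
  imports "HOL-Analysis.Analysis"
begin

definition fock_measure :: "complex measure" where
  "fock_measure = density lborel (\<lambda>z. ennreal (exp (- (cmod z)\<^sup>2) / pi))"

(* Elements are genuine functions, not classes modulo null sets: two entire functions that
   agree almost everywhere are equal. *)
definition fock_space :: "(complex \<Rightarrow> complex) set" where
  "fock_space = {f. f holomorphic_on UNIV \<and> integrable fock_measure (\<lambda>z. (cmod (f z))\<^sup>2)}"

definition fock_inner :: "(complex \<Rightarrow> complex) \<Rightarrow> (complex \<Rightarrow> complex) \<Rightarrow> complex" where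
  "fock_inner f g = (LINT z|fock_measure. f z * cnj (g z))"

definition fock_norm :: "(complex \<Rightarrow> complex) \<Rightarrow> real" where
  "fock_norm f = sqrt (Re (fock_inner f f))"

definition weighted_comp ::
  "(complex \<Rightarrow> complex) \<Rightarrow> (complex \<Rightarrow> complex) \<Rightarrow> (complex \<Rightarrow> complex) \<Rightarrow> complex \<Rightarrow> complex" where
  "weighted_comp \<psi> \<phi> h = (\<lambda>z. \<psi> z * h (\<phi> z))"

(* An operator is a total map on functions, of which only the values on the Fock space matter.
   Linearity is not required here; weighted composition operators are linear by construction. *)
definition fock_bounded :: "((complex \<Rightarrow> complex) \<Rightarrow> complex \<Rightarrow> complex) \<Rightarrow> bool" where
  "fock_bounded T \<longleftrightarrow>
     (\<forall>f\<in>fock_space. T f \<in> fock_space) \<and>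
     (\<exists>K. \<forall>f\<in>fock_space. fock_norm (T f) \<le> K * fock_norm f)"

definition numerical_range ::
  "((complex \<Rightarrow> complex) \<Rightarrow> complex \<Rightarrow> complex) \<Rightarrow> complex set" where
  "numerical_range T = {fock_inner (T f) f | f. f \<in> fock_space \<and> fock_norm f = 1}"

definition root_of_unity :: "complex \<Rightarrow> bool" where
  "root_of_unity a \<longleftrightarrow> (\<exists>n::nat. 0 < n \<and> a ^ n = 1)"

definition primitive_root_of_unity :: "nat \<Rightarrow> complex \<Rightarrow> bool" where
  "primitive_root_of_unity n a \<longleftrightarrow>
     0 < n \<and> a ^ n = 1 \<and> (\<forall>k. 0 < k \<and> k < n \<longrightarrow> a ^ k \<noteq> 1)"

(* The filled polygon with vertices 1, a, ..., a^(n-1); a segment when n = 2. *)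
definition root_polygon :: "nat \<Rightarrow> complex \<Rightarrow> complex set" where
  "root_polygon n a = convex hull {a ^ k | k. k < n}"

end

theory Submission
  imports Defs "HOL-Complex_Analysis.Complex_Analysis" "HOL-Real_Asymp.Real_Asymp"
begin

text \<open>Testing boundedness on the kernel functions and applying Liouville's theorem shows that
  the symbol is \<open>\<psi> 0 * exp (- a * cnj b * z)\<close>, so the operator is a multiple of a unitary
  Weyl operator. If \<open>a \<noteq> 1\<close>, this unitary is a rotation about the fixed point
  \<open>c = b / (1 - a)\<close> with eigenvectors \<open>(z - c)^m * exp (cnj c * z)\<close> for the eigenvalues
  \<open>a^m\<close>. By the Toeplitz--Hausdorff theorem the numerical range contains the convex hull of the
  powers of \<open>a\<close>. Conversely, if \<open>a^n = 1\<close>, splitting a unit vector into eigenvectors writes its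
  value as a convex combination of powers of \<open>a\<close>; in general the values lie in the closed unit
  disc, and a value on the circle is an eigenvalue by equality in Cauchy--Schwarz. If \<open>a = 1\<close>,
  there are no eigenvalues, conjugation with other Weyl operators makes the numerical range
  rotation invariant, and approximate eigenvectors push it up to the unit circle.\<close>

section \<open>Lebesgue measure under rigid motions of the plane\<close>

text \<open>For a \<noteq> 1 the constant in the result is the value of \<psi> at the fixed point c
  = b / (1 - a): the exponent of the symbol there is - a * cnj b * c = a * |b|^2 / (a - 1). It is
  also the eigenvalue of the operator at the kernel function exp (cnj c * z). A translation with b
  \<noteq> 0 has no fixed point; there exp (|b|^2 / 2) is just the factor that makes the Weyl
  operator isometric, and phases do not matter because the range is a disc about 0. In the
  irrational and the translation case the delicate points are those on the unit circle: convexity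
  and density only settle the open disc. Translations have no eigenvectors that reach the circle, so
  approximate ones are built from powers of the isometry. Two analytic facts carry everything:
  invariance of Lebesgue measure under rigid motions, and the mean value over a disc, which turns
  integral information into pointwise information.\<close>

lemma nn_integral_lborel_shift:
  fixes f :: "'a::euclidean_space \<Rightarrow> ennreal"
  assumes [measurable]: "f \<in> borel_measurable borel"
  shows "(\<integral>\<^sup>+x. f (c + x) \<partial>lborel) = (\<integral>\<^sup>+x. f x \<partial>lborel)"
  by (subst (2) lborel_distr_plus[of c, symmetric]) (simp add: nn_integral_distr)

lemma nn_integral_lborel_reflect:
  fixes f :: "'a::euclidean_space \<Rightarrow> ennreal"
  assumes [measurable]: "f \<in> borel_measurable borel"
  shows "(\<integral>\<^sup>+x. f (c - x) \<partial>lborel) = (\<integral>\<^sup>+x. f x \<partial>lborel)"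
  by (subst (2) lborel_affine[of "-1" c]) (simp_all add: nn_integral_distr density_1)

text \<open>The argument for uniqueness of Haar measure: multiplied by the area of the unit disc,
  the integral becomes a double integral in which translations and a reflection alone move the
  rotation from \<open>f\<close> onto the disc indicator \<open>g\<close>, which does not see it.
  The area is positive and finite, so it cancels.\<close>

lemma nn_integral_lborel_rotate:
  fixes f :: "complex \<Rightarrow> ennreal" and a :: complex
  assumes [measurable]: "f \<in> borel_measurable borel" and a: "cmod a = 1"
  shows "(\<integral>\<^sup>+x. f (a * x) \<partial>lborel) = (\<integral>\<^sup>+x. f x \<partial>lborel)"
proof -
  define g where "g = (indicator (ball 0 1) :: complex \<Rightarrow> ennreal)"
  have [measurable]: "g \<in> borel_measurable borel" unfolding g_def by (intro borel_measurable_indicator) simp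
  have a0: "a \<noteq> 0" using a by auto
  have [measurable]: "ball (0::complex) 1 \<in> sets borel" by simp
  have g: "(\<integral>\<^sup>+y. g y \<partial>lborel) = emeasure lborel (ball (0::complex) 1)"
    by (simp add: g_def)
  have swap: "(\<integral>\<^sup>+x. (\<integral>\<^sup>+y. F x y \<partial>lborel) \<partial>lborel) = (\<integral>\<^sup>+y. (\<integral>\<^sup>+x. F x y \<partial>lborel) \<partial>lborel)"
    if "case_prod F \<in> borel_measurable (lborel \<Otimes>\<^sub>M lborel)" for F :: "complex \<Rightarrow> complex \<Rightarrow> ennreal"
    by (rule lborel_pair.Fubini'[OF that, symmetric])
  have "(\<integral>\<^sup>+x. f (a * x) \<partial>lborel) * (\<integral>\<^sup>+y. g y \<partial>lborel)
      = (\<integral>\<^sup>+x. (\<integral>\<^sup>+y. f (a * x) * g y \<partial>lborel) \<partial>lborel)"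
    by (simp add: nn_integral_cmult nn_integral_multc)
  also have "\<dots> = (\<integral>\<^sup>+x. (\<integral>\<^sup>+y. f (a * x) * g (y - a * x) \<partial>lborel) \<partial>lborel)"
  proof (rule nn_integral_cong)
    fix x
    show "(\<integral>\<^sup>+y. f (a * x) * g y \<partial>lborel) = (\<integral>\<^sup>+y. f (a * x) * g (y - a * x) \<partial>lborel)"
      using nn_integral_lborel_shift[of "\<lambda>y. f (a * x) * g y" "- (a * x)"]
      by (simp add: algebra_simps)
  qed
  also have "\<dots> = (\<integral>\<^sup>+y. (\<integral>\<^sup>+x. f (a * x) * g (y - a * x) \<partial>lborel) \<partial>lborel)"
    by (rule swap) measurable
  also have "\<dots> = (\<integral>\<^sup>+y. (\<integral>\<^sup>+x. f (y - a * x) * g (a * x) \<partial>lborel) \<partial>lborel)"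
  proof (rule nn_integral_cong)
    fix y
    \<comment> \<open>The reflection x -> y / a - x exchanges \<open>a * x\<close> and
      \<open>y - a * x\<close>.\<close>
    show "(\<integral>\<^sup>+x. f (a * x) * g (y - a * x) \<partial>lborel) = (\<integral>\<^sup>+x. f (y - a * x) * g (a * x) \<partial>lborel)"
      using nn_integral_lborel_reflect[of "\<lambda>x. f (y - a * x) * g (a * x)" "y / a"] a0
      by (simp add: algebra_simps)
  qed
  also have "\<dots> = (\<integral>\<^sup>+y. (\<integral>\<^sup>+x. f (y - a * x) * g x \<partial>lborel) \<partial>lborel)"
    using a by (simp add: g_def indicator_def norm_mult dist_norm)
  also have "\<dots> = (\<integral>\<^sup>+x. (\<integral>\<^sup>+y. f (y - a * x) * g x \<partial>lborel) \<partial>lborel)"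
    by (rule swap) measurable
  also have "\<dots> = (\<integral>\<^sup>+x. (\<integral>\<^sup>+y. f y * g x \<partial>lborel) \<partial>lborel)"
  proof (rule nn_integral_cong)
    fix x
    show "(\<integral>\<^sup>+y. f (y - a * x) * g x \<partial>lborel) = (\<integral>\<^sup>+y. f y * g x \<partial>lborel)"
      using nn_integral_lborel_shift[of "\<lambda>y. f y * g x" "- (a * x)"]
      by (simp add: algebra_simps)
  qed
  also have "\<dots> = (\<integral>\<^sup>+x. f x \<partial>lborel) * (\<integral>\<^sup>+y. g y \<partial>lborel)"
    by (simp add: nn_integral_cmult nn_integral_multc)
  finally have "(\<integral>\<^sup>+x. f (a * x) \<partial>lborel) * emeasure lborel (ball (0::complex) 1)
      = (\<integral>\<^sup>+x. f x \<partial>lborel) * emeasure lborel (ball (0::complex) 1)"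
    by (simp only: g)
  moreover have "emeasure lborel (ball (0::complex) 1) \<noteq> 0"
    "emeasure lborel (ball (0::complex) 1) \<noteq> \<infinity>"
    by (simp_all add: emeasure_ball unit_ball_vol_2)
  ultimately show ?thesis
    by (simp add: mult.commute[of _ "emeasure _ _"] ennreal_mult_cancel_left)
qed

lemma lborel_distr_rigid:
  fixes a b :: complex
  assumes a: "cmod a = 1"
  shows "distr lborel borel (\<lambda>z. a * z + b) = (lborel :: complex measure)"
proof (rule measure_eqI)
  fix X assume "X \<in> sets (distr lborel borel (\<lambda>z. a * z + b))"
  then have [measurable]: "X \<in> sets borel" by simp
  have "emeasure (distr lborel borel (\<lambda>z. a * z + b)) X
      = (\<integral>\<^sup>+z. indicator X (b + a * z) \<partial>lborel)"
    by (subst nn_integral_indicator[symmetric], simp, subst nn_integral_distr)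
       (simp_all add: add.commute)
  also have "\<dots> = (\<integral>\<^sup>+z. indicator X (b + z) \<partial>lborel)"
    by (rule nn_integral_lborel_rotate[OF _ a]) measurable
  also have "\<dots> = (\<integral>\<^sup>+z. indicator X z \<partial>lborel)"
    by (rule nn_integral_lborel_shift) measurable
  finally show "emeasure (distr lborel borel (\<lambda>z. a * z + b)) X = emeasure lborel X"
    by simp
qed simp

lemma
  fixes f :: "complex \<Rightarrow> 'a::{banach, second_countable_topology}"
  assumes [measurable]: "f \<in> borel_measurable borel" and a: "cmod a = 1"
  shows integrable_lborel_rigid: "integrable lborel (\<lambda>z. f (a * z + b)) \<longleftrightarrow> integrable lborel f"
    and integral_lborel_rigid: "(LINT z|lborel. f (a * z + b)) = (LINT z|lborel. f z)"
proof -
  show "integrable lborel (\<lambda>z. f (a * z + b)) \<longleftrightarrow> integrable lborel f"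
    by (subst (2) lborel_distr_rigid[OF a, of b, symmetric]) (simp add: integrable_distr_eq)
  show "(LINT z|lborel. f (a * z + b)) = (LINT z|lborel. f z)"
    by (subst (2) lborel_distr_rigid[OF a, of b, symmetric]) (simp add: integral_distr)
qed

text \<open>Averaging Cauchy's formula over circles of all radii below 1.\<close>
lemma mean_value_disc:
  fixes h :: "complex \<Rightarrow> complex"
  assumes h: "h holomorphic_on UNIV"
  shows "(LINT z|lborel. indicator (ball 0 1) z *\<^sub>R h (w + z)) = of_real pi * h w"
proof -
  define e where "e t = exp (2 * of_real pi * \<i> * of_real t)" for t :: real
  have cont_e: "continuous_on S e" for S
    unfolding e_def by (intro continuous_intros)
  then have [measurable]: "e \<in> borel_measurable borel"
    by (rule borel_measurable_continuous_onI)
  have [measurable]: "ball (0::complex) 1 \<in> sets borel" by simp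
  have e1: "cmod (e t) = 1" for t
    by (simp add: e_def norm_exp_eq_Re)
  have cont: "continuous_on UNIV h"
    using h by (rule holomorphic_on_imp_continuous_on)
  then have [measurable]: "h \<in> borel_measurable borel"
    by (rule borel_measurable_continuous_onI)
  have circle: "((\<lambda>t. h (w + z * e t)) has_integral h w) {0..1}" for z
  proof -
    have "(\<lambda>u. h (w + z * u)) holomorphic_on UNIV"
      by (rule holomorphic_on_compose_gen[OF _ h, unfolded o_def]) (auto intro!: holomorphic_intros)
    then have "(\<lambda>u. h (w + z * u)) holomorphic_on cball 0 1"
      by (rule holomorphic_on_subset) auto
    from Cauchy_integral_circlepath_simple[OF this, of 0]
    have "((\<lambda>u. h (w + z * u) / u) has_contour_integral (2 * of_real pi * \<i> * h w)) (circlepath 0 1)"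
      by simp
    then have "((\<lambda>t. 2 * of_real pi * \<i> * h (w + z * e t)) has_integral (2 * of_real pi * \<i> * h w)) {0..1}"
      unfolding has_contour_integral
      by (rule has_integral_eq[rotated])
         (simp add: vector_derivative_circlepath, simp add: circlepath e_def)
    from has_integral_mult_right[OF this, of "inverse (2 * of_real pi * \<i>)"]
    show ?thesis
      by (simp add: field_simps)
  qed
  have circle': "(LINT t|lborel. indicator {0..1} t *\<^sub>R h (w + z * e t)) = h w" for z
  proof -
    have "set_integrable lborel {0..1} (\<lambda>t. h (w + z * e t))"
      unfolding set_integrable_def
      by (rule borel_integrable_compact)
         (auto intro!: continuous_intros cont_e continuous_on_compose2[OF cont])
    then have "(LINT t:{0..1}|lborel. h (w + z * e t)) = integral {0..1} (\<lambda>t. h (w + z * e t))"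
      by (rule set_borel_integral_eq_integral)
    also have "\<dots> = h w"
      using circle by (rule integral_unique)
    finally show ?thesis
      by (simp add: set_lebesgue_integral_def)
  qed
  \<comment> \<open>Rotating the whole disc replaces polar coordinates. For fixed \<open>z\<close>
    the integral over \<open>t\<close> is a circle average, equal to \<open>h w\<close>; for fixed
    \<open>t\<close> the rotation by \<open>e t\<close> does not change the integral over
    \<open>z\<close>. Fubini equates the two.\<close>
  define F where "F t z = indicator ({0..1} \<times> ball 0 1) (t, z) *\<^sub>R h (w + z * e t)" for t z
  have F: "F t z = indicator {0..1} t *\<^sub>R (indicator (ball 0 1) z *\<^sub>R h (w + z * e t))" for t z
    by (simp add: F_def indicator_def)
  have "compact (h ` cball w 1)"
    using cont by (intro compact_continuous_image) (auto intro: continuous_on_subset)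
  from compact_imp_bounded[OF this]
  obtain B where "\<forall>x\<in>h ` cball w 1. norm x \<le> B"
    unfolding bounded_iff by blast
  then have B: "\<And>u. u \<in> cball w 1 \<Longrightarrow> norm (h u) \<le> B"
    by blast
  have int: "integrable (lborel \<Otimes>\<^sub>M lborel) (case_prod F)"
  proof (rule integrableI_bounded_set)
    show "({0..1} \<times> ball 0 1 :: (real \<times> complex) set) \<in> sets (lborel \<Otimes>\<^sub>M lborel)"
      by simp
    show "case_prod F \<in> borel_measurable (lborel \<Otimes>\<^sub>M lborel)"
      unfolding F by measurable
    show "emeasure (lborel \<Otimes>\<^sub>M lborel) ({0..1} \<times> ball 0 1 :: (real \<times> complex) set) < \<infinity>"
      by (subst lborel.emeasure_pair_measure_Times)
         (simp_all add: emeasure_ball ennreal_mult_less_top)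
    show "AE x in lborel \<Otimes>\<^sub>M lborel. x \<in> {0..1} \<times> ball 0 1 \<longrightarrow> norm (case_prod F x) \<le> B"
      using B e1 by (auto simp: F_def dist_norm norm_mult)
    show "AE x in lborel \<Otimes>\<^sub>M lborel. x \<notin> {0..1} \<times> ball 0 1 \<longrightarrow> case_prod F x = 0"
      by (rule AE_I2) (auto simp: F_def indicator_def)
  qed
  have "(LINT z|lborel. (LINT t|lborel. F t z)) = (LINT t|lborel. (LINT z|lborel. F t z))"
    by (rule lborel_pair.Fubini_integral[OF int])
  moreover have "(LINT t|lborel. F t z) = indicator (ball 0 1) z *\<^sub>R h w" for z
    unfolding F using circle'[of z] by (cases "z \<in> ball 0 1") auto
  moreover have "(LINT z|lborel. F t z) =
      indicator {0..1} t *\<^sub>R (LINT z|lborel. indicator (ball 0 1) z *\<^sub>R h (w + z))" for t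
  proof -
    have "(LINT z|lborel. indicator (ball 0 1) z *\<^sub>R h (w + z * e t))
        = (LINT z|lborel. indicator (ball 0 1) (e t * z + 0) *\<^sub>R h (w + (e t * z + 0)))"
      using e1 by (intro Bochner_Integration.integral_cong) (auto simp: indicator_def dist_norm norm_mult mult.commute)
    also have "\<dots> = (LINT z|lborel. indicator (ball 0 1) z *\<^sub>R h (w + z))"
      by (rule integral_lborel_rigid[where f="\<lambda>z. indicator (ball 0 1) z *\<^sub>R h (w + z)", OF _ e1]) measurable
    finally show ?thesis unfolding F by (simp del: scaleR_scaleR)
  qed
  ultimately show ?thesis
    by (simp add: content_ball unit_ball_vol_2 scaleR_conv_of_real)
qed

section \<open>Fock space\<close>

lemma borel_measurable_cnj [measurable (raw)]:
  "f \<in> borel_measurable M \<Longrightarrow> (\<lambda>x. cnj (f x)) \<in> borel_measurable M"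
  by (rule borel_measurable_continuous_on) (auto intro!: continuous_intros)

lemma fock_density_measurable [measurable]:
  "(\<lambda>z::complex. exp (- (cmod z)\<^sup>2) / pi) \<in> borel_measurable borel"
  by (intro borel_measurable_continuous_onI continuous_intros) auto

lemma sets_fock_measure [measurable_cong]: "sets fock_measure = sets borel"
  by (simp add: fock_measure_def)

lemma
  fixes f :: "complex \<Rightarrow> 'a::{banach, second_countable_topology}"
  assumes [measurable]: "f \<in> borel_measurable borel"
  shows integrable_fock_measure: "integrable fock_measure f \<longleftrightarrow>
      integrable lborel (\<lambda>z. (exp (- (cmod z)\<^sup>2) / pi) *\<^sub>R f z)"
    and integral_fock_measure: "(LINT z|fock_measure. f z) =
      (LINT z|lborel. (exp (- (cmod z)\<^sup>2) / pi) *\<^sub>R f z)"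
  unfolding fock_measure_def by (subst integrable_density integral_density; simp)+

lemma fock_space_holomorphic: "f \<in> fock_space \<Longrightarrow> f holomorphic_on UNIV"
  by (simp add: fock_space_def)

lemma holomorphic_measurable: "f holomorphic_on UNIV \<Longrightarrow> f \<in> borel_measurable borel"
  by (intro borel_measurable_continuous_onI holomorphic_on_imp_continuous_on)

lemma fock_space_measurable: "f \<in> fock_space \<Longrightarrow> f \<in> borel_measurable borel"
  by (intro holomorphic_measurable fock_space_holomorphic)

lemma fock_space_integrable: "f \<in> fock_space \<Longrightarrow> integrable fock_measure (\<lambda>z. (cmod (f z))\<^sup>2)"
  by (simp add: fock_space_def)

lemma fock_space_0: "(\<lambda>_. 0) \<in> fock_space"
  by (simp add: fock_space_def)

lemma fock_space_lin:
  assumes f: "f \<in> fock_space" and g: "g \<in> fock_space"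
  shows "(\<lambda>z. x * f z + y * g z) \<in> fock_space"
proof -
  note [measurable] = f[THEN fock_space_measurable] g[THEN fock_space_measurable]
  have "integrable fock_measure (\<lambda>z. (cmod (x * f z + y * g z))\<^sup>2)"
  proof (rule Bochner_Integration.integrable_bound)
    show "integrable fock_measure
        (\<lambda>z. 2 * (cmod x)\<^sup>2 * (cmod (f z))\<^sup>2 + 2 * (cmod y)\<^sup>2 * (cmod (g z))\<^sup>2)"
      using f g by (intro Bochner_Integration.integrable_add integrable_mult_right fock_space_integrable)
    have "(cmod (u + v))\<^sup>2 \<le> 2 * (cmod u)\<^sup>2 + 2 * (cmod v)\<^sup>2" for u v
    proof -
      have "(cmod (u + v))\<^sup>2 \<le> (cmod u + cmod v)\<^sup>2"
        by (intro power_mono norm_triangle_ineq) simp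
      also have "\<dots> \<le> 2 * (cmod u)\<^sup>2 + 2 * (cmod v)\<^sup>2"
        using sum_squares_bound[of "cmod u" "cmod v"] by (simp add: power2_sum)
      finally show ?thesis .
    qed
    from this[of "x * f _" "y * g _"]
    show "AE z in fock_measure. norm ((cmod (x * f z + y * g z))\<^sup>2)
        \<le> norm (2 * (cmod x)\<^sup>2 * (cmod (f z))\<^sup>2 + 2 * (cmod y)\<^sup>2 * (cmod (g z))\<^sup>2)"
      by (simp add: norm_mult power_mult_distrib mult.assoc)
  qed measurable
  moreover have "(\<lambda>z. x * f z + y * g z) holomorphic_on UNIV"
    using f g by (intro holomorphic_intros fock_space_holomorphic)
  ultimately show ?thesis
    by (simp add: fock_space_def)
qed

lemma fock_space_scale: "f \<in> fock_space \<Longrightarrow> (\<lambda>z. x * f z) \<in> fock_space"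
  using fock_space_lin[of f f x 0] by simp

lemma fock_space_sum:
  "(\<And>i. i \<in> I \<Longrightarrow> F i \<in> fock_space) \<Longrightarrow> (\<lambda>z. \<Sum>i\<in>I. x i * F i z) \<in> fock_space"
proof (induction I rule: infinite_finite_induct)
  case (insert i I)
  then show ?case
    using fock_space_lin[of "F i" "\<lambda>z. \<Sum>i\<in>I. x i * F i z" "x i" 1] by simp
qed (simp_all add: fock_space_0)

lemma fock_inner_integrable:
  assumes f: "f \<in> fock_space" and g: "g \<in> fock_space"
  shows "integrable fock_measure (\<lambda>z. f z * cnj (g z))"
proof (rule Bochner_Integration.integrable_bound)
  note [measurable] = f[THEN fock_space_measurable] g[THEN fock_space_measurable]
  show "(\<lambda>z. f z * cnj (g z)) \<in> borel_measurable fock_measure"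
    by measurable
  show "integrable fock_measure (\<lambda>z. (cmod (f z))\<^sup>2 + (cmod (g z))\<^sup>2)"
    using f g by (intro Bochner_Integration.integrable_add fock_space_integrable)
  have "u * v \<le> u\<^sup>2 + v\<^sup>2" if "0 \<le> u" "0 \<le> v" for u v :: real
    using sum_squares_bound[of u v] mult_nonneg_nonneg[OF that] by linarith
  then show "AE z in fock_measure. norm (f z * cnj (g z))
      \<le> norm ((cmod (f z))\<^sup>2 + (cmod (g z))\<^sup>2)"
    by (simp add: norm_mult)
qed

section \<open>Sesquilinearity of the inner product, and the norm\<close>

lemma fock_inner_lin_left:
  assumes "f \<in> fock_space" "g \<in> fock_space" "h \<in> fock_space"
  shows "fock_inner (\<lambda>z. x * f z + y * g z) h = x * fock_inner f h + y * fock_inner g h"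
proof -
  have "fock_inner (\<lambda>z. x * f z + y * g z) h =
      (LINT z|fock_measure. x * (f z * cnj (h z)) + y * (g z * cnj (h z)))"
    by (simp add: fock_inner_def algebra_simps)
  also have "\<dots> = x * fock_inner f h + y * fock_inner g h"
    using assms by (simp add: fock_inner_def fock_inner_integrable)
  finally show ?thesis .
qed

lemma fock_inner_commute: "fock_inner g f = cnj (fock_inner f g)"
  unfolding fock_inner_def
  by (subst Bochner_Integration.integral_cnj[symmetric]) (simp add: mult.commute)

lemma fock_inner_lin_right:
  assumes "f \<in> fock_space" "g \<in> fock_space" "h \<in> fock_space"
  shows "fock_inner h (\<lambda>z. x * f z + y * g z) = cnj x * fock_inner h f + cnj y * fock_inner h g"
  using fock_inner_lin_left[OF assms, of x y]
  by (subst (1 2 3) fock_inner_commute) simp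

lemma fock_inner_scale_left: "fock_inner (\<lambda>z. x * f z) g = x * fock_inner f g"
  by (simp add: fock_inner_def mult.assoc)

lemma fock_inner_scale_right: "fock_inner f (\<lambda>z. x * g z) = cnj x * fock_inner f g"
  by (simp add: fock_inner_def mult.assoc mult.left_commute[of _ "cnj x"])

lemma fock_inner_sum_left:
  assumes "\<And>i. i \<in> I \<Longrightarrow> F i \<in> fock_space" "h \<in> fock_space"
  shows "fock_inner (\<lambda>z. \<Sum>i\<in>I. x i * F i z) h = (\<Sum>i\<in>I. x i * fock_inner (F i) h)"
  using assms(1)
proof (induction I rule: infinite_finite_induct)
  case (insert i I)
  then show ?case
    using fock_inner_lin_left[of "F i" "\<lambda>z. \<Sum>i\<in>I. x i * F i z" h "x i" 1] assms(2)
    by (simp add: fock_space_sum)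
qed (simp_all add: fock_inner_def)

lemma fock_inner_sum_right:
  assumes "\<And>i. i \<in> I \<Longrightarrow> F i \<in> fock_space" "h \<in> fock_space"
  shows "fock_inner h (\<lambda>z. \<Sum>i\<in>I. x i * F i z) = (\<Sum>i\<in>I. cnj (x i) * fock_inner h (F i))"
proof -
  have "fock_inner h (\<lambda>z. \<Sum>i\<in>I. x i * F i z) = cnj (fock_inner (\<lambda>z. \<Sum>i\<in>I. x i * F i z) h)"
    by (rule fock_inner_commute)
  also have "\<dots> = (\<Sum>i\<in>I. cnj (x i) * cnj (fock_inner (F i) h))"
    using fock_inner_sum_left[OF assms, where x = x] by simp
  finally show ?thesis
    by (simp flip: fock_inner_commute)
qed

lemma fock_inner_self: "fock_inner f f = of_real (LINT z|fock_measure. (cmod (f z))\<^sup>2)"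
  using integral_complex_of_real[of fock_measure "\<lambda>z. (cmod (f z))\<^sup>2"]
  by (simp add: fock_inner_def flip: complex_norm_square)

lemma fock_norm_square: "(fock_norm f)\<^sup>2 = (LINT z|fock_measure. (cmod (f z))\<^sup>2)"
  by (simp add: fock_norm_def fock_inner_self)

lemma fock_inner_norm: "fock_inner f f = of_real ((fock_norm f)\<^sup>2)"
  by (simp add: fock_inner_self fock_norm_square)

lemma fock_norm_nonneg: "0 \<le> fock_norm f"
  by (simp add: fock_norm_def fock_inner_self)

lemma fock_norm_scale: "fock_norm (\<lambda>z. x * f z) = cmod x * fock_norm f"
proof -
  have "(fock_norm (\<lambda>z. x * f z))\<^sup>2 = (cmod x * fock_norm f)\<^sup>2"
    by (simp add: fock_norm_square norm_mult power_mult_distrib)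
  then show ?thesis
    by (simp add: fock_norm_nonneg)
qed

text \<open>Elements are functions, not classes, so vanishing almost everywhere has to be upgraded
  to every point: by the mean value over the disc around \<open>w\<close>, the value
  \<open>f w\<close> is an average of a function that is zero almost everywhere.\<close>

lemma fock_norm_eq_0:
  assumes f: "f \<in> fock_space" and "fock_norm f = 0"
  shows "f = (\<lambda>_. 0)"
proof
  fix w
  note [measurable] = f[THEN fock_space_measurable]
  have [measurable]: "ball (0::complex) 1 \<in> sets borel" by simp
  have "(LINT z|fock_measure. (cmod (f z))\<^sup>2) = 0"
    using assms(2) fock_norm_square[of f] by simp
  then have "AE z in fock_measure. (cmod (f z))\<^sup>2 = 0"
    using f by (subst (asm) integral_nonneg_eq_0_iff_AE) (simp_all add: fock_space_integrable)
  then have ae: "AE z in lborel. f z = 0"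
    unfolding fock_measure_def by (subst (asm) AE_density) auto
  let ?g = "\<lambda>z. indicator (ball 0 1) (z - w) *\<^sub>R f z"
  have "of_real pi * f w = (LINT z|lborel. ?g (1 * z + w))"
    using mean_value_disc[OF fock_space_holomorphic[OF f], of w] by (simp add: add.commute)
  also have "\<dots> = (LINT z|lborel. ?g z)"
    by (rule integral_lborel_rigid) simp_all
  also have "\<dots> = 0"
    by (rule integral_eq_zero_AE) (use ae in auto)
  finally show "f w = 0" by simp
qed

text \<open>For |a| = 1 this is the unitary lift of the rigid motion \<open>z \<mapsto> a z + b\<close>: the factor
  compensates the change of the Gaussian weight.\<close>
definition weyl :: "complex \<Rightarrow> complex \<Rightarrow> (complex \<Rightarrow> complex) \<Rightarrow> complex \<Rightarrow> complex" where
  "weyl a b f = (\<lambda>z. exp (- (a * cnj b * z) - of_real ((cmod b)\<^sup>2 / 2)) * f (a * z + b))"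

lemma cmod_rigid_square:
  assumes "cmod a = 1"
  shows "(cmod (a * z + b))\<^sup>2 = (cmod z)\<^sup>2 + 2 * Re (a * cnj b * z) + (cmod b)\<^sup>2"
proof -
  have "(cmod (a * z + b))\<^sup>2 = (cmod (a * z))\<^sup>2 + 2 * Re (a * cnj b * z) + (cmod b)\<^sup>2"
    by (simp only: cmod_power2) (simp add: power2_eq_square algebra_simps)
  with assms show ?thesis by (simp add: norm_mult)
qed

text \<open>The squared modulus of the exponential factor is the quotient of the Gaussian weights at
  \<open>a * z + b\<close> and \<open>z\<close>. The pointwise form gives membership and inner
  products by a change of variables, and later the periodicity of an eigenvector's density.\<close>

lemma weyl_density:
  assumes "cmod a = 1"
  shows "(exp (- (cmod z)\<^sup>2) / pi) *\<^sub>R (weyl a b f z * cnj (weyl a b g z)) =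
    (exp (- (cmod (a * z + b))\<^sup>2) / pi) *\<^sub>R (f (a * z + b) * cnj (g (a * z + b)))"
proof -
  let ?E = "exp (- (a * cnj b * z) - of_real ((cmod b)\<^sup>2 / 2))"
  have "?E * cnj ?E = of_real ((cmod ?E)\<^sup>2)"
    by (simp flip: complex_norm_square)
  also have "(cmod ?E)\<^sup>2 = exp (- 2 * Re (a * cnj b * z) - (cmod b)\<^sup>2)"
    by (simp add: norm_exp_eq_Re flip: exp_double)
  finally have "?E * cnj ?E = of_real (exp (- 2 * Re (a * cnj b * z) - (cmod b)\<^sup>2))" .
  moreover have "exp (- (cmod z)\<^sup>2) * exp (- 2 * Re (a * cnj b * z) - (cmod b)\<^sup>2) =
      exp (- (cmod (a * z + b))\<^sup>2)"
    unfolding cmod_rigid_square[OF assms] by (simp flip: exp_add add: algebra_simps)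
  moreover have "weyl a b f z * cnj (weyl a b g z) =
      (?E * cnj ?E) * (f (a * z + b) * cnj (g (a * z + b)))"
    by (simp add: weyl_def algebra_simps)
  ultimately show ?thesis
    by (simp add: scaleR_conv_of_real flip: of_real_mult mult.assoc)
qed

lemma weyl_holomorphic:
  assumes f: "f holomorphic_on UNIV"
  shows "weyl a b f holomorphic_on UNIV"
proof -
  have "(\<lambda>z. f (a * z + b)) holomorphic_on UNIV"
    by (rule holomorphic_on_compose_gen[OF _ f, unfolded o_def]) (auto intro!: holomorphic_intros)
  then show ?thesis
    unfolding weyl_def by (intro holomorphic_intros)
qed

lemma weyl_fock_space:
  assumes f: "f \<in> fock_space" and a: "cmod a = 1"
  shows "weyl a b f \<in> fock_space"
proof -
  have hol: "weyl a b f holomorphic_on UNIV"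
    using f by (intro weyl_holomorphic fock_space_holomorphic)
  note [measurable] = f[THEN fock_space_measurable] hol[THEN holomorphic_measurable]
  have *: "integrable fock_measure (\<lambda>z. (cmod (h z))\<^sup>2) \<longleftrightarrow> integrable fock_measure (\<lambda>z. h z * cnj (h z))"
    for h by (subst complex_of_real_integrable_eq[symmetric])
      (simp flip: complex_norm_square)
  let ?k = "\<lambda>z. (exp (- (cmod z)\<^sup>2) / pi) *\<^sub>R (f z * cnj (f z))"
  have "integrable fock_measure (\<lambda>z. f z * cnj (f z))"
    using f by (intro fock_inner_integrable)
  then have "integrable lborel ?k"
    by (subst (asm) integrable_fock_measure) measurable
  then have "integrable lborel (\<lambda>z. ?k (a * z + b))"
    by (subst integrable_lborel_rigid[OF _ a]) measurable
  then have "integrable fock_measure (\<lambda>z. weyl a b f z * cnj (weyl a b f z))"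
    by (subst integrable_fock_measure) (measurable, simp only: weyl_density[OF a])
  then show ?thesis
    using hol by (simp add: fock_space_def *)
qed

lemma weyl_inner:
  assumes "f \<in> fock_space" "g \<in> fock_space" and a: "cmod a = 1"
  shows "fock_inner (weyl a b f) (weyl a b g) = fock_inner f g"
proof -
  have hol: "weyl a b f holomorphic_on UNIV" "weyl a b g holomorphic_on UNIV"
    by (intro weyl_holomorphic fock_space_holomorphic assms)+
  note [measurable] = assms(1,2)[THEN fock_space_measurable] hol[THEN holomorphic_measurable]
  let ?k = "\<lambda>z. (exp (- (cmod z)\<^sup>2) / pi) *\<^sub>R (f z * cnj (g z))"
  have "fock_inner (weyl a b f) (weyl a b g) = (LINT z|lborel. ?k (a * z + b))"
    unfolding fock_inner_def
    by (subst integral_fock_measure) (measurable, simp only: weyl_density[OF a])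
  also have "\<dots> = (LINT z|lborel. ?k z)"
    by (rule integral_lborel_rigid[OF _ a]) measurable
  also have "\<dots> = fock_inner f g"
    unfolding fock_inner_def by (subst integral_fock_measure) measurable
  finally show ?thesis .
qed

section \<open>Isometries and numerical ranges\<close>

definition fock_linear :: "((complex \<Rightarrow> complex) \<Rightarrow> complex \<Rightarrow> complex) \<Rightarrow> bool" where
  "fock_linear T \<longleftrightarrow> (\<forall>f\<in>fock_space. T f \<in> fock_space) \<and>
     (\<forall>f\<in>fock_space. \<forall>g\<in>fock_space. \<forall>x y. T (\<lambda>z. x * f z + y * g z) = (\<lambda>z. x * T f z + y * T g z))"

definition fock_isometry :: "((complex \<Rightarrow> complex) \<Rightarrow> complex \<Rightarrow> complex) \<Rightarrow> bool" where
  "fock_isometry T \<longleftrightarrow> fock_linear T \<and>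
     (\<forall>f\<in>fock_space. \<forall>g\<in>fock_space. fock_inner (T f) (T g) = fock_inner f g)"

lemma fock_linear_mem: "fock_linear T \<Longrightarrow> f \<in> fock_space \<Longrightarrow> T f \<in> fock_space"
  by (simp add: fock_linear_def)

lemma fock_linear_lin:
  "fock_linear T \<Longrightarrow> f \<in> fock_space \<Longrightarrow> g \<in> fock_space \<Longrightarrow>
    T (\<lambda>z. x * f z + y * g z) = (\<lambda>z. x * T f z + y * T g z)"
  by (simp add: fock_linear_def)

lemma fock_linear_scale:
  "fock_linear T \<Longrightarrow> f \<in> fock_space \<Longrightarrow> T (\<lambda>z. x * f z) = (\<lambda>z. x * T f z)"
  using fock_linear_lin[of T f f x 0] by simp

lemma fock_linear_sum:
  assumes T: "fock_linear T" and "finite I" "\<And>i. i \<in> I \<Longrightarrow> F i \<in> fock_space"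
  shows "T (\<lambda>z. \<Sum>i\<in>I. x i * F i z) = (\<lambda>z. \<Sum>i\<in>I. x i * T (F i) z)"
  using assms(2,3)
proof (induction I rule: finite_induct)
  case empty
  then show ?case
    using fock_linear_scale[OF T fock_space_0, of 0] by simp
next
  case (insert i I)
  then show ?case
    using fock_linear_lin[OF T, of "F i" "\<lambda>z. \<Sum>i\<in>I. x i * F i z" "x i" 1]
    by (simp add: fock_space_sum)
qed

section \<open>Numerical ranges of linear maps and their convexity\<close>

lemma numerical_range_memI:
  assumes "f \<in> fock_space" "fock_norm f = 1"
  shows "fock_inner (T f) f \<in> numerical_range T"
  using assms by (auto simp: numerical_range_def)

lemma numerical_range_quotient:
  assumes T: "fock_linear T" and f: "f \<in> fock_space" "fock_norm f \<noteq> 0"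
  shows "fock_inner (T f) f / of_real ((fock_norm f)\<^sup>2) \<in> numerical_range T"
proof -
  let ?c = "of_real (1 / fock_norm f) :: complex"
  have "fock_norm (\<lambda>z. ?c * f z) = 1"
    unfolding fock_norm_scale using f fock_norm_nonneg[of f] by (simp add: norm_divide)
  then have "fock_inner (T (\<lambda>z. ?c * f z)) (\<lambda>z. ?c * f z) \<in> numerical_range T"
    using f by (intro numerical_range_memI fock_space_scale)
  then show ?thesis
    by (simp only: fock_linear_scale[OF T f(1)] fock_inner_scale_left fock_inner_scale_right)
       (simp add: power2_eq_square)
qed

lemma numerical_range_eigenvalue:
  assumes f: "f \<in> fock_space" "fock_norm f \<noteq> 0" and T: "fock_linear T" "T f = (\<lambda>z. x * f z)"
  shows "x \<in> numerical_range T"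
  using numerical_range_quotient[OF T(1) f] f(2) by (simp add: T(2) fock_inner_scale_left fock_inner_norm)

lemma fock_inner_lin_lin:
  assumes "f \<in> fock_space" "g \<in> fock_space" "f' \<in> fock_space" "g' \<in> fock_space"
  shows "fock_inner (\<lambda>z. x * f' z + y * g' z) (\<lambda>z. x * f z + y * g z) =
    x * cnj x * fock_inner f' f + x * cnj y * fock_inner f' g +
    y * cnj x * fock_inner g' f + y * cnj y * fock_inner g' g"
  using assms by (simp add: fock_inner_lin_left fock_inner_lin_right fock_space_lin algebra_simps)

text \<open>Conjugation flips the sign of the imaginary part, so only \<open>u * (R - cnj P)\<close>
  matters; \<open>u\<close> is the phase that rotates \<open>R - cnj P\<close> onto the positive
  real axis.\<close>

lemma unit_phase_real: "\<exists>u. cmod u = 1 \<and> Im (cnj u * P + u * R) = 0"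
proof (cases "R = cnj P")
  case True
  then show ?thesis by (intro exI[of _ 1]) simp
next
  case False
  let ?D = "R - cnj P"
  let ?u = "cnj ?D / of_real (cmod ?D)"
  have "Im (cnj u * P + u * R) = Im (u * ?D)" for u
    by (simp add: algebra_simps)
  then have "Im (cnj ?u * P + ?u * R) = Im (?u * ?D)" .
  also have "?u * ?D = ?D * cnj ?D / of_real (cmod ?D)"
    by (simp only: times_divide_eq_left times_divide_eq_right mult.commute)
  also have "\<dots> = of_real (cmod ?D)"
    using False by (simp only: flip: complex_norm_square) (simp add: power2_eq_square)
  finally have "Im (cnj ?u * P + ?u * R) = 0"
    by (simp only: Im_complex_of_real)
  moreover have "cmod ?u = 1"
    using False by (simp only: norm_divide complex_mod_cnj norm_of_real) simp
  ultimately show ?thesis by blast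
qed

text \<open>Toeplitz--Hausdorff: normalise the two values to 0 and 1, choose a phase making the
  cross terms on the segment between the two vectors real, and use the intermediate value theorem.\<close>
theorem convex_numerical_range:
  assumes T: "fock_linear T"
  shows "convex (numerical_range T)"
  unfolding convex_alt
proof (intro ballI allI impI)
  fix A B :: complex and t :: real
  assume A: "A \<in> numerical_range T" and B: "B \<in> numerical_range T" and t: "0 \<le> t \<and> t \<le> 1"
  from A obtain f where f: "f \<in> fock_space" "fock_norm f = 1" "A = fock_inner (T f) f"
    by (auto simp: numerical_range_def)
  from B obtain g where g: "g \<in> fock_space" "fock_norm g = 1" "B = fock_inner (T g) g"
    by (auto simp: numerical_range_def)
  show "(1 - t) *\<^sub>R A + t *\<^sub>R B \<in> numerical_range T"
  proof (cases "A = B")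
    case True
    then show ?thesis using A by (simp flip: scaleR_left_distrib)
  next
    case AB: False
    \<comment> \<open>\<open>P\<close> and \<open>R\<close> are the cross terms of (T - A) / (B -
      A), whose values at \<open>f\<close> and \<open>g\<close> are 0 and 1.\<close>
    define P where "P = (fock_inner (T f) g - A * fock_inner f g) / (B - A)"
    define R where "R = (fock_inner (T g) f - A * fock_inner g f) / (B - A)"
    obtain u where u: "cmod u = 1" "Im (cnj u * P + u * R) = 0"
      using unit_phase_real by blast
    define \<rho> where "\<rho> = Re (cnj u * P + u * R)"
    have \<rho>: "cnj u * P + u * R = of_real \<rho>"
      using u(2) by (simp add: \<rho>_def complex_eq_iff)
    have uu: "u * cnj u = 1"
      using u(1) by (simp flip: complex_norm_square)
    define c where "c = 2 * Re (u * fock_inner g f)"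
    have c: "cnj u * fock_inner f g + u * fock_inner g f = of_real c"
      using complex_add_cnj[of "u * fock_inner g f"]
      by (simp add: c_def add.commute flip: fock_inner_commute)
    define h where "h s = (\<lambda>z. of_real (1 - s) * f z + of_real s * u * g z)" for s :: real
    define N where "N s = (1 - s)\<^sup>2 + s\<^sup>2 + s * (1 - s) * c" for s
    define Q where "Q s = s\<^sup>2 + s * (1 - s) * \<rho>" for s
    have h: "h s \<in> fock_space" for s
      unfolding h_def using f g by (intro fock_space_lin)
    have Th: "T (h s) = (\<lambda>z. of_real (1 - s) * T f z + of_real s * u * T g z)" for s
      unfolding h_def using f g by (intro fock_linear_lin[OF T])
    have hh: "fock_inner (h s) (h s) = of_real (N s)" for s
    proof -
      have "fock_inner (h s) (h s) = of_real ((1 - s)\<^sup>2) +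
          of_real (s * (1 - s)) * (cnj u * fock_inner f g + u * fock_inner g f)
          + of_real (s\<^sup>2) * (u * cnj u)"
        unfolding h_def using f g
        by (subst fock_inner_lin_lin) (simp_all add: fock_inner_norm power2_eq_square algebra_simps)
      then show ?thesis by (simp add: c uu N_def)
    qed
    have qh: "fock_inner (T (h s)) (h s) = A * of_real (N s) + (B - A) * of_real (Q s)" for s
    proof -
      have PR: "fock_inner (T f) g = (B - A) * P + A * fock_inner f g"
        "fock_inner (T g) f = (B - A) * R + A * fock_inner g f"
        using AB by (simp_all add: P_def R_def)
      have "fock_inner (T (h s)) (h s) = of_real ((1 - s)\<^sup>2) * A +
          of_real (s * (1 - s)) * (cnj u * fock_inner (T f) g + u * fock_inner (T g) f)
          + of_real (s\<^sup>2) * (u * cnj u) * B"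
        unfolding Th unfolding h_def using f g
        by (subst fock_inner_lin_lin)
           (simp_all add: fock_linear_mem[OF T] power2_eq_square algebra_simps)
      also have "cnj u * fock_inner (T f) g + u * fock_inner (T g) f =
          (B - A) * (cnj u * P + u * R) + A * (cnj u * fock_inner f g + u * fock_inner g f)"
        unfolding PR by (simp add: algebra_simps)
      finally show ?thesis
        unfolding \<rho> c uu by (simp add: N_def Q_def algebra_simps)
    qed
    \<comment> \<open>The normalised value at \<open>h s\<close> is \<open>Q s / N s\<close>. Using
      the difference, which is - t at 0 and 1 - t at 1, instead of the quotient means that
      \<open>N s\<close> must be nonzero only at the \<open>s\<close> found.\<close>
    have "\<exists>s\<ge>0. s \<le> 1 \<and> Q s - t * N s = 0"
      by (rule IVT') (use t in \<open>auto simp: Q_def N_def intro!: continuous_intros\<close>)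
    then obtain s where s: "0 \<le> s" "s \<le> 1" "Q s = t * N s"
      by auto
    have N: "N s = (fock_norm (h s))\<^sup>2"
      using hh[of s] by (simp add: fock_inner_norm flip: of_real_power)
    \<comment> \<open>If \<open>h s\<close> vanished, \<open>f\<close> would be a unimodular
      multiple of \<open>g\<close>, forcing A = B.\<close>
    have "fock_norm (h s) \<noteq> 0"
    proof
      assume "fock_norm (h s) = 0"
      then have "h s = (\<lambda>_. 0)"
        by (rule fock_norm_eq_0[OF h])
      then have 0: "of_real (1 - s) * f z + of_real s * u * g z = 0" for z
        unfolding h_def by meson
      have s1: "s \<noteq> 1"
      proof
        assume "s = 1"
        moreover have "u \<noteq> 0" using uu by auto
        ultimately have "g z = 0" for z using 0[of z] by simp
        then have "fock_norm g = 0"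
          by (simp add: fock_norm_def fock_inner_def)
        with g show False by simp
      qed
      define k where "k = - (of_real s * u / of_real (1 - s))"
      have fk: "f = (\<lambda>z. k * g z)"
      proof
        fix z
        have "of_real (1 - s) * f z = - (of_real s * u * g z)"
          using 0[of z] by (simp add: add_eq_0_iff2)
        then show "f z = k * g z"
          using s1 by (simp add: k_def field_simps)
      qed
      have "cmod k = 1"
        using f(2) g(2) by (simp add: fk fock_norm_scale)
      then have "k * cnj k = 1"
        by (simp flip: complex_norm_square)
      moreover have "A = k * cnj k * B"
        unfolding f(3) g(3) fk fock_linear_scale[OF T g(1)] fock_inner_scale_left
          fock_inner_scale_right by simp
      ultimately show False using AB by simp
    qed
    then have "fock_inner (T (h s)) (h s) / of_real (N s) \<in> numerical_range T" "N s \<noteq> 0"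
      using numerical_range_quotient[OF T h, of s] by (simp_all add: N)
    moreover have "fock_inner (T (h s)) (h s) = ((1 - t) *\<^sub>R A + t *\<^sub>R B) * of_real (N s)"
      unfolding qh s(3) by (simp add: scaleR_conv_of_real algebra_simps)
    ultimately show ?thesis by simp
  qed
qed

section \<open>Isometries: values on and near the unit circle\<close>

lemma fock_isometry_linear: "fock_isometry T \<Longrightarrow> fock_linear T"
  by (simp add: fock_isometry_def)

lemma fock_isometry_norm:
  assumes "fock_isometry T" "f \<in> fock_space"
  shows "fock_norm (T f) = fock_norm f"
  using assms by (simp add: fock_norm_def fock_isometry_def)

lemma fock_norm_lin_square:
  assumes "f \<in> fock_space" "g \<in> fock_space"
  shows "(fock_norm (\<lambda>z. f z + y * g z))\<^sup>2 =
    (fock_norm f)\<^sup>2 + 2 * Re (cnj y * fock_inner f g) + (cmod y)\<^sup>2 * (fock_norm g)\<^sup>2"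
proof -
  have "fock_inner (\<lambda>z. f z + y * g z) (\<lambda>z. f z + y * g z) =
      fock_inner f f + (cnj y * fock_inner f g + y * fock_inner g f) + y * cnj y * fock_inner g g"
    using fock_inner_lin_lin[OF assms assms, of 1 y] by (simp add: algebra_simps)
  also have "y * fock_inner g f = cnj (cnj y * fock_inner f g)"
    by (simp flip: fock_inner_commute)
  also have "cnj y * fock_inner f g + cnj (cnj y * fock_inner f g) =
      of_real (2 * Re (cnj y * fock_inner f g))"
    by (rule complex_add_cnj)
  also have "y * cnj y = of_real ((cmod y)\<^sup>2)"
    by (simp only: complex_norm_square)
  finally show ?thesis
    by (simp only: fock_inner_norm flip: of_real_add of_real_mult) (simp only: of_real_eq_iff)
qed

lemma fock_isometry_defect:
  assumes T: "fock_isometry T" and f: "f \<in> fock_space" "fock_norm f = 1"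
  shows "(fock_norm (\<lambda>z. T f z - x * f z))\<^sup>2 = 1 - 2 * Re (cnj x * fock_inner (T f) f) + (cmod x)\<^sup>2"
  using fock_norm_lin_square[OF fock_linear_mem[OF fock_isometry_linear[OF T] f(1)] f(1), of "- x"] T f
  by (simp add: fock_isometry_norm)

text \<open>With the value \<open>x\<close> itself as candidate eigenvalue, the squared norm of T f
  - x f is 1 - |x|^2. It is nonnegative, and it vanishes exactly in the equality case.\<close>

lemma
  assumes T: "fock_isometry T" and f: "f \<in> fock_space" "fock_norm f = 1"
  defines "x \<equiv> fock_inner (T f) f"
  shows fock_isometry_inner_le: "cmod x \<le> 1"
    and fock_isometry_inner_eq: "cmod x = 1 \<Longrightarrow> T f = (\<lambda>z. x * f z)"
proof -
  have "Re (cnj x * x) = (cmod x)\<^sup>2"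
    by (simp add: cmod_power2, simp add: power2_eq_square)
  then have *: "(fock_norm (\<lambda>z. T f z - x * f z))\<^sup>2 = 1 - (cmod x)\<^sup>2"
    using fock_isometry_defect[OF T f, of x] by (simp add: x_def)
  then have "(cmod x)\<^sup>2 \<le> 1"
    using zero_le_power2[of "fock_norm (\<lambda>z. T f z - x * f z)"] by linarith
  then show "cmod x \<le> 1"
    by (simp add: power_le_one_iff abs_le_square_iff[of _ 1, simplified])
  assume "cmod x = 1"
  with * have "fock_norm (\<lambda>z. T f z - x * f z) = 0"
    by simp
  moreover have "(\<lambda>z. T f z - x * f z) \<in> fock_space"
    using fock_space_lin[OF fock_linear_mem[OF fock_isometry_linear[OF T] f(1)] f(1), of 1 "- x"]
    by simp
  ultimately have "(\<lambda>z. T f z - x * f z) = (\<lambda>_. 0)"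
    by (intro fock_norm_eq_0)
  then show "T f = (\<lambda>z. x * f z)"
    by (auto simp: fun_eq_iff)
qed

lemma fock_isometry_comp:
  assumes T: "fock_isometry T"
  shows "fock_isometry (\<lambda>f. T (T f))"
  using assms unfolding fock_isometry_def fock_linear_def by auto

text \<open>The approximate eigenvector is \<open>\<Prod>j<n. (T^(2^j) + \<mu>\<^sub>j)\<close> applied to a unit vector, where
  the \<open>\<mu>\<^sub>j\<close> are successive square roots; by the parallelogram law one of the two roots
  at least doubles the squared norm.\<close>
lemma fock_isometry_approx_eigenvector:
  assumes "fock_isometry T" and f: "f \<in> fock_space" "fock_norm f = 1"
  shows "\<exists>h\<in>fock_space. \<exists>x. cmod x = 1 \<and> (fock_norm (\<lambda>z. T h z - x * h z))\<^sup>2 \<le> 4 \<and>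
    2 ^ n \<le> (fock_norm h)\<^sup>2"
  using assms(1)
proof (induction n arbitrary: T)
  case (0 T)
  have parallelogram: "(fock_norm (\<lambda>z. T f z - 1 * f z))\<^sup>2 + (fock_norm (\<lambda>z. T f z - (-1) * f z))\<^sup>2 = 4"
    unfolding fock_isometry_defect[OF 0 f] by simp
  then have "(fock_norm (\<lambda>z. T f z - 1 * f z))\<^sup>2 \<le> 4"
    using zero_le_power2[of "fock_norm (\<lambda>z. T f z - (-1) * f z)"] by linarith
  then show ?case
    using f by (intro bexI[of _ f] exI[of _ 1]) auto
next
  case (Suc n T)
  note T = fock_isometry_linear[OF Suc.prems]
  obtain h x where h: "h \<in> fock_space" "cmod x = 1"
      "(fock_norm (\<lambda>z. T (T h) z - x * h z))\<^sup>2 \<le> 4" "2 ^ n \<le> (fock_norm h)\<^sup>2"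
    using Suc.IH[OF fock_isometry_comp[OF Suc.prems]] by blast
  define r where "r = csqrt x"
  have r: "r * r = x"
    unfolding r_def using power2_csqrt[of x] by (simp add: power2_eq_square)
  have cr: "cmod r = 1"
    using h(2) by (simp add: r_def)
  define k where "k y = (\<lambda>z. T h z + y * h z)" for y
  have k: "k y \<in> fock_space" for y
    unfolding k_def using fock_space_lin[OF fock_linear_mem[OF T h(1)] h(1), of 1 y] by simp
  \<comment> \<open>(T - y) (T + y) = T^2 - y^2: the defect of \<open>k y\<close> under
    \<open>T\<close> is that of \<open>h\<close> under T^2, hence still at most 4, while a good
    choice of \<open>y\<close> doubles the squared norm.\<close>
  have Tk: "T (k y) z - y * k y z = T (T h) z - y * y * h z" for y z
    using fun_cong[OF fock_linear_lin[OF T fock_linear_mem[OF T h(1)] h(1), of 1 y], of z]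
    by (simp add: k_def algebra_simps)
  have "(fock_norm (k r))\<^sup>2 + (fock_norm (k (- r)))\<^sup>2 = 4 * (fock_norm h)\<^sup>2"
    using fock_norm_lin_square[OF fock_linear_mem[OF T h(1)] h(1), of r]
      fock_norm_lin_square[OF fock_linear_mem[OF T h(1)] h(1), of "- r"] cr
    by (simp add: k_def fock_isometry_norm[OF Suc.prems h(1)])
  then have "2 * 2 ^ n \<le> (fock_norm (k r))\<^sup>2 \<or> 2 * 2 ^ n \<le> (fock_norm (k (- r)))\<^sup>2"
    using h(4) by linarith
  then obtain y where y: "y = r \<or> y = - r" "2 * 2 ^ n \<le> (fock_norm (k y))\<^sup>2"
    by blast
  then have "y * y = x" "cmod y = 1"
    using r cr by auto
  then show ?case
    using h(3) y(2) k by (intro bexI[of _ "k y"] exI[of _ y]) (simp_all add: Tk)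
qed

text \<open>An approximate eigenvector with squared defect at most 4 and squared norm N \<ge> 2^n
  has a Rayleigh quotient of modulus at least 1 - 2 / N, and 2 / N tends to 0 as n grows.\<close>

lemma fock_isometry_numerical_radius:
  assumes T: "fock_isometry T" and f: "f \<in> fock_space" "fock_norm f = 1" and "r < 1"
  shows "\<exists>s\<in>numerical_range T. r < cmod s"
proof -
  obtain n where n: "(1 / 2) ^ n < (1 - r) / 2"
    using real_arch_pow_inv[of "(1 - r) / 2" "1 / 2"] \<open>r < 1\<close> by auto
  obtain h x where h: "h \<in> fock_space" "cmod x = 1"
      "(fock_norm (\<lambda>z. T h z - x * h z))\<^sup>2 \<le> 4" "2 ^ n \<le> (fock_norm h)\<^sup>2"
    using fock_isometry_approx_eigenvector[OF T f] by blast
  have "0 < (fock_norm h)\<^sup>2"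
    using h(4) zero_less_power[of "2::real" n] by linarith
  then have h0: "fock_norm h \<noteq> 0" by auto
  note lin = fock_isometry_linear[OF T]
  let ?N = "(fock_norm h)\<^sup>2"
  let ?s = "fock_inner (T h) h / of_real ?N"
  have "(fock_norm (\<lambda>z. T h z - x * h z))\<^sup>2 = 2 * ?N - 2 * Re (cnj x * fock_inner (T h) h)"
    using fock_norm_lin_square[OF fock_linear_mem[OF lin h(1)] h(1), of "- x"] h(2)
    by (simp add: fock_isometry_norm[OF T h(1)])
  with h(3) have "?N - 2 \<le> Re (cnj x * fock_inner (T h) h)"
    by simp
  also have "\<dots> \<le> cmod (cnj x * fock_inner (T h) h)"
    by (rule complex_Re_le_cmod)
  also have "\<dots> = cmod (fock_inner (T h) h)"
    using h(2) by (simp add: norm_mult)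
  finally have "(?N - 2) / ?N \<le> cmod (fock_inner (T h) h) / ?N"
    by (rule divide_right_mono) simp
  moreover have "(?N - 2) / ?N = 1 - 2 / ?N"
    using h0 by (simp add: diff_divide_distrib)
  moreover have "cmod (fock_inner (T h) h) / ?N = cmod ?s"
    by (simp add: norm_divide norm_power)
  ultimately have "1 - 2 / ?N \<le> cmod ?s"
    by simp
  moreover have "2 / ?N \<le> 2 / 2 ^ n"
    using h(4) by (intro divide_left_mono) (auto intro: mult_pos_pos \<open>0 < ?N\<close>)
  moreover have "2 / 2 ^ n < 1 - r"
    using n by (simp add: power_divide)
  ultimately have "r < cmod ?s" by linarith
  then show ?thesis
    using numerical_range_quotient[OF lin h(1) h0] by blast
qed

text \<open>The vectors \<open>G k = (1/n) \<Sum>j<n. a^(-jk) T^j f\<close> are mutually orthogonal eigenvectors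
  with eigenvalues \<open>a^k\<close>, and they sum up to \<open>f\<close>.\<close>
lemma numerical_range_cyclic:
  assumes T: "fock_isometry T" and a: "primitive_root_of_unity n a"
    and cyc: "\<And>f. f \<in> fock_space \<Longrightarrow> (T ^^ n) f = f"
  shows "numerical_range T \<subseteq> root_polygon n a"
proof
  fix v assume "v \<in> numerical_range T"
  then obtain f where f: "f \<in> fock_space" "fock_norm f = 1" and v: "v = fock_inner (T f) f"
    by (auto simp: numerical_range_def)
  note lin = fock_isometry_linear[OF T]
  have n: "0 < n" "a ^ n = 1" and prim: "\<And>k. 0 < k \<Longrightarrow> k < n \<Longrightarrow> a ^ k \<noteq> 1"
    using a by (auto simp: primitive_root_of_unity_def)
  then have a0: "a \<noteq> 0" by (auto simp: power_0_left split: if_splits)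
  have ca: "cmod a = 1"
    using power_eq_1_iff[OF n(2)] n(1) by auto
  have Tn: "(T ^^ j) f \<in> fock_space" for j
    by (induction j) (simp_all add: f fock_linear_mem[OF lin])
  define G where "G k = (\<lambda>z. \<Sum>j<n. (inverse a ^ (j * k) / of_nat n) * (T ^^ j) f z)" for k
  have G: "G k \<in> fock_space" for k
    unfolding G_def by (intro fock_space_sum Tn)
  have sumG: "(\<Sum>k<n. G k z) = f z" for z
  proof -
    have char: "(\<Sum>k<n. inverse a ^ (j * k) / of_nat n) = (if j = 0 then 1 else 0)" if "j < n" for j
    proof (cases "j = 0")
      case False
      let ?q = "inverse a ^ j"
      have "?q \<noteq> 1"
        using prim[of j] False that by (simp add: power_inverse)
      moreover have "?q ^ n = 1"
        using n(2) by (metis mult.commute power_inverse inverse_1 power_mult power_one)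
      ultimately have "(\<Sum>k<n. ?q ^ k) = 0"
        by (simp add: geometric_sum)
      with False show ?thesis
        by (simp add: power_mult flip: sum_divide_distrib)
    qed (use n in simp)
    have "(\<Sum>k<n. G k z) = (\<Sum>j<n. (\<Sum>k<n. inverse a ^ (j * k) / of_nat n) * (T ^^ j) f z)"
      unfolding G_def by (subst sum.swap) (simp add: sum_distrib_right)
    also have "\<dots> = (\<Sum>j<n. (if j = 0 then 1 else 0) * (T ^^ j) f z)"
      by (intro sum.cong refl) (simp add: char)
    also have "\<dots> = f z"
      using n(1) by (simp add: if_distrib[of "\<lambda>x. x * _"] sum.delta cong: if_cong)
    finally show ?thesis .
  qed
  have TG: "T (G k) = (\<lambda>z. a ^ k * G k z)" for k
  proof
    fix z
    define c where "c j = inverse a ^ (j * k) / of_nat n * (T ^^ j) f z" for j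
    have "T (G k) z = (\<Sum>j<n. inverse a ^ (j * k) / of_nat n * (T ^^ Suc j) f z)"
      unfolding G_def by (subst fock_linear_sum[OF lin]) (simp_all add: Tn)
    also have "\<dots> = (\<Sum>j<n. a ^ k * c (Suc j))"
      using a0 by (intro sum.cong refl) (simp add: c_def power_add field_simps)
    also have "\<dots> = a ^ k * (\<Sum>j<n. c (Suc j))"
      by (simp add: sum_distrib_left)
    \<comment> \<open>Applying \<open>T\<close> shifts the index by one; T^n f = f and a^n = 1 close
      the cycle.\<close>
    also have "c n = c 0"
      using n(2) cyc[OF f(1)] by (simp add: c_def power_mult power_inverse)
    then have "(\<Sum>j<n. c (Suc j)) = (\<Sum>j<n. c j)"
      using sum.lessThan_Suc_shift[of c n] sum.lessThan_Suc[of c n] by simp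
    finally show "T (G k) z = a ^ k * G k z"
      by (simp add: c_def G_def)
  qed
  \<comment> \<open>Preserving the inner product multiplies it by
    \<open>a ^ k * cnj (a ^ l)\<close>. As |a| = 1, that factor is 1 only if
    \<open>a ^ (l - k) = 1\<close>, which primitivity excludes.\<close>
  have orth: "fock_inner (G k) (G l) = 0" if "k < l" "l < n" for k l
  proof -
    have "fock_inner (G k) (G l) = fock_inner (T (G k)) (T (G l))"
      using T G by (simp add: fock_isometry_def)
    also have "\<dots> = a ^ k * cnj (a ^ l) * fock_inner (G k) (G l)"
      unfolding TG fock_inner_scale_left fock_inner_scale_right by simp
    finally have "fock_inner (G k) (G l) = 0 \<or> a ^ k * cnj (a ^ l) = 1"
      by simp
    moreover have "a ^ k * cnj (a ^ l) \<noteq> 1"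
    proof
      assume *: "a ^ k * cnj (a ^ l) = 1"
      have "a ^ l * cnj (a ^ l) = of_real ((cmod (a ^ l))\<^sup>2)"
        by (simp only: complex_norm_square)
      then have "a ^ l * cnj (a ^ l) = 1"
        using ca by (simp add: norm_power)
      then have "a ^ l = a ^ k"
        using * by (metis mult.commute mult.left_commute mult.right_neutral)
      moreover have "a ^ l = a ^ k * a ^ (l - k)"
        using that by (simp flip: power_add)
      ultimately have "a ^ (l - k) = 1"
        using a0 by simp
      moreover have "0 < l - k" "l - k < n" using that by arith+
      ultimately show False using prim by blast
    qed
    ultimately show ?thesis by blast
  qed
  have orth': "fock_inner (G k) (G l) = 0" if "k \<noteq> l" "k < n" "l < n" for k l
    using that orth[of k l] orth[of l k] fock_inner_commute[of "G k" "G l"]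
    by (cases "k < l") auto
  have sum_inner: "fock_inner (\<lambda>z. \<Sum>k<n. x k * G k z) f =
      (\<Sum>k<n. x k * of_real ((fock_norm (G k))\<^sup>2))" for x
  proof -
    have "fock_inner (\<lambda>z. \<Sum>k<n. x k * G k z) f = (\<Sum>k<n. x k * fock_inner (G k) f)"
      by (intro fock_inner_sum_left G f)
    also have "\<dots> = (\<Sum>k<n. x k * of_real ((fock_norm (G k))\<^sup>2))"
    proof (intro sum.cong refl, goal_cases)
      case (1 k)
      have "fock_inner (G k) f = fock_inner (G k) (\<lambda>z. \<Sum>l<n. 1 * G l z)"
        by (simp add: sumG)
      also have "\<dots> = (\<Sum>l<n. fock_inner (G k) (G l))"
        by (subst fock_inner_sum_right) (simp_all add: G)
      also have "\<dots> = (\<Sum>l<n. if l = k then fock_inner (G k) (G k) else 0)"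
        using 1 orth' by (intro sum.cong) auto
      also have "\<dots> = of_real ((fock_norm (G k))\<^sup>2)"
        using 1 by (simp add: fock_inner_norm)
      finally show ?case by simp
    qed
    finally show ?thesis .
  qed
  have "f = (\<lambda>z. \<Sum>k<n. 1 * G k z)"
    by (simp add: sumG)
  then have "T f = (\<lambda>z. \<Sum>k<n. 1 * T (G k) z)"
    using fock_linear_sum[OF lin, of "{..<n}" G "\<lambda>_. 1"] G by simp
  then have "v = (\<Sum>k<n. a ^ k * of_real ((fock_norm (G k))\<^sup>2))"
    unfolding v by (simp add: TG sum_inner)
  then have v_sum: "v = (\<Sum>k<n. (fock_norm (G k))\<^sup>2 *\<^sub>R a ^ k)"
    by (simp add: scaleR_conv_of_real mult.commute)
  have "of_real (\<Sum>k<n. (fock_norm (G k))\<^sup>2) = fock_inner f f"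
    using sum_inner[of "\<lambda>_. 1"] by (simp add: sumG)
  then have "(\<Sum>k<n. (fock_norm (G k))\<^sup>2) = 1"
    unfolding fock_inner_norm f(2) by (simp only: of_real_eq_iff) simp
  then show "v \<in> root_polygon n a"
    unfolding v_sum root_polygon_def
    by (intro convex_sum convex_convex_hull) (auto intro: hull_inc)
qed

section \<open>Weyl operators and bounded symbols\<close>

text \<open>On the annulus k \<le> |z| < k + 1 the integrand is at most \<open>?B k\<close>, and the
  annulus is enlarged to the disc of radius k + 1. The areas grow only quadratically, so the
  resulting series is dominated by the geometric series of exp (- k).\<close>

lemma monomial_fock_space: "(\<lambda>z. z ^ m) \<in> fock_space"
proof -
  let ?F = "\<lambda>z::complex. (exp (- (cmod z)\<^sup>2) / pi) * (cmod (z ^ m))\<^sup>2"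
  let ?B = "\<lambda>k::nat. exp (- (real k)\<^sup>2) * (real k + 1) ^ (2 * m)"
  have "integrable lborel ?F"
  proof (rule integrableI_nonneg)
    show "?F \<in> borel_measurable lborel"
      by measurable
    have bound: "ennreal (?F z) \<le> (\<Sum>k. ennreal (?B k) * indicator (ball 0 (real k + 1)) z)" for z
    proof -
      define k where "k = nat \<lfloor>cmod z\<rfloor>"
      have k: "real k \<le> cmod z" "cmod z < real k + 1"
        unfolding k_def by (simp_all add: of_nat_nat)
      have "exp (- (cmod z)\<^sup>2) / pi \<le> exp (- (cmod z)\<^sup>2) / 1"
        using pi_ge_two by (intro divide_left_mono) auto
      moreover have "(cmod (z ^ m))\<^sup>2 = (cmod z) ^ (2 * m)"
        by (simp only: norm_power power_even_eq)
      ultimately have "?F z \<le> exp (- (cmod z)\<^sup>2) * (cmod z) ^ (2 * m)"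
        by (simp only: div_by_1) (rule mult_right_mono, simp_all)
      also have "\<dots> \<le> ?B k"
        using k by (intro mult_mono power_mono) (auto intro: power_mono)
      finally have "ennreal (?F z) \<le> ennreal (?B k)"
        by (rule ennreal_leI)
      also have "\<dots> = (\<Sum>j\<in>{k}. ennreal (?B j) * indicator (ball 0 (real j + 1)) z)"
        using k by (simp add: dist_norm)
      also have "\<dots> \<le> (\<Sum>j. ennreal (?B j) * indicator (ball 0 (real j + 1)) z)"
        by (rule sum_le_suminf) (auto intro: summableI)
      finally show ?thesis .
    qed
    have "(\<integral>\<^sup>+z. ennreal (?F z) \<partial>lborel) \<le>
        (\<integral>\<^sup>+z. (\<Sum>k. ennreal (?B k) * indicator (ball (0::complex) (real k + 1)) z) \<partial>lborel)"
      by (rule nn_integral_mono) (rule bound)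
    also have "\<dots> = (\<Sum>k. ennreal (?B k) * emeasure lborel (ball (0::complex) (real k + 1)))"
    proof (subst nn_integral_suminf)
      have [measurable]: "ball (0::complex) r \<in> sets borel" for r
        by simp
      show "(\<lambda>z. ennreal (?B k) * indicator (ball (0::complex) (real k + 1)) z) \<in> borel_measurable lborel" for k
        by measurable
    qed (simp add: nn_integral_cmult_indicator)
    also have "\<dots> = (\<Sum>k. ennreal (?B k * (pi * (real k + 1)\<^sup>2)))"
      by (simp add: emeasure_ball unit_ball_vol_2 ennreal_mult)
    also have "\<dots> < \<infinity>"
    proof -
      have "summable (\<lambda>k. ?B k * (pi * (real k + 1)\<^sup>2))"
      proof (rule summable_comparison_test_bigo)
        have "summable (\<lambda>k. exp (- 1 :: real) ^ k)"
          by (rule summable_geometric) simp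
        then show "summable (\<lambda>k. norm (exp (- real k)))"
          by (simp flip: exp_of_nat_mult)
        have "(\<lambda>k. exp (- (real k)\<^sup>2) * (real k + 1) ^ p) \<in> O(\<lambda>k. exp (- real k))" for p
          by real_asymp
        from landau_o.big.cmult_in_iff[THEN iffD2, OF _ this[of "2 * m + 2"], of pi]
        show "(\<lambda>k. ?B k * (pi * (real k + 1)\<^sup>2)) \<in> O(\<lambda>k. exp (- real k))"
          by (simp add: power_add power2_eq_square mult_ac)
      qed
      then have "(\<Sum>k. ennreal (?B k * (pi * (real k + 1)\<^sup>2))) \<noteq> top"
        by (rule ennreal_suminf_neq_top) simp
      then show ?thesis by (simp add: top.not_eq_extremum)
    qed
    finally show "(\<integral>\<^sup>+z. ennreal (?F z) \<partial>lborel) < \<infinity>" .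
  qed simp
  then have "integrable fock_measure (\<lambda>z. (cmod (z ^ m))\<^sup>2)"
    by (subst integrable_fock_measure) simp_all
  then show ?thesis
    by (auto simp: fock_space_def intro!: holomorphic_intros)
qed

section \<open>Weyl operators as isometries, and shifted vectors\<close>

lemma weyl_norm:
  assumes "f \<in> fock_space" "cmod a = 1"
  shows "fock_norm (weyl a b f) = fock_norm f"
  using weyl_inner[OF assms(1) assms(1) assms(2)] by (simp add: fock_norm_def)

lemma weyl_isometry:
  assumes "cmod a = 1"
  shows "fock_isometry (weyl a b)"
proof -
  have "weyl a b (\<lambda>z. x * f z + y * g z) = (\<lambda>z. x * weyl a b f z + y * weyl a b g z)" for x y f g
    by (simp add: weyl_def algebra_simps)
  then show ?thesis
    using assms by (simp add: fock_isometry_def fock_linear_def weyl_fock_space weyl_inner)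
qed

text \<open>Up to the factor exp (|c|^2 / 2) this is \<open>weyl 1 (- c) f\<close>. The constant 1
  yields the kernel functions that test boundedness, the monomials yield the eigenvectors of
  rotations about \<open>c\<close>.\<close>

lemma fock_space_coherent:
  assumes "f \<in> fock_space"
  shows "(\<lambda>z. f (z - c) * exp (cnj c * z)) \<in> fock_space"
    and "fock_norm (\<lambda>z. f (z - c) * exp (cnj c * z)) = exp ((cmod c)\<^sup>2 / 2) * fock_norm f"
proof -
  have *: "(\<lambda>z. f (z - c) * exp (cnj c * z)) =
      (\<lambda>z. of_real (exp ((cmod c)\<^sup>2 / 2)) * weyl 1 (- c) f z)"
  proof
    fix z
    have "of_real (exp ((cmod c)\<^sup>2 / 2)) * weyl 1 (- c) f z =
        exp (of_real ((cmod c)\<^sup>2 / 2) + (- (1 * cnj (- c) * z) - of_real ((cmod (- c))\<^sup>2 / 2))) * f (1 * z + - c)"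
      unfolding weyl_def exp_of_real[symmetric] exp_add by (simp only: mult.assoc)
    then show "f (z - c) * exp (cnj c * z) = of_real (exp ((cmod c)\<^sup>2 / 2)) * weyl 1 (- c) f z"
      by simp
  qed
  show "(\<lambda>z. f (z - c) * exp (cnj c * z)) \<in> fock_space"
    unfolding * using assms by (intro fock_space_scale weyl_fock_space) simp_all
  show "fock_norm (\<lambda>z. f (z - c) * exp (cnj c * z)) = exp ((cmod c)\<^sup>2 / 2) * fock_norm f"
    unfolding * fock_norm_scale using assms by (simp add: weyl_norm)
qed

lemma fock_const_1: "(\<lambda>_. 1) \<in> fock_space"
  using monomial_fock_space[of 0] by simp

lemma fock_norm_neq_0: "f \<in> fock_space \<Longrightarrow> f z \<noteq> 0 \<Longrightarrow> fock_norm f \<noteq> 0"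
  using fock_norm_eq_0 by fastforce

lemma fock_unit_vector_exists: "\<exists>f\<in>fock_space. fock_norm f = 1"
proof -
  have "fock_norm (\<lambda>_. 1) \<noteq> 0"
    by (rule fock_norm_neq_0[OF fock_const_1]) simp
  then have "fock_norm (\<lambda>_. of_real (1 / fock_norm (\<lambda>_. 1)) * 1) = 1"
    unfolding fock_norm_scale by (simp add: norm_divide fock_norm_nonneg)
  then show ?thesis
    using fock_space_scale[OF fock_const_1] by blast
qed

text \<open>On the unit disc around \<open>w\<close> the Gaussian is at least exp (- 1), and |g|
  \<le> 1 + |g|^2. The mean value over that disc therefore bounds |g w| by a constant independent of
  \<open>w\<close>, and Liouville's theorem applies.\<close>

lemma entire_constant_of_local_L2_bound:
  assumes g: "g holomorphic_on UNIV"
    and int: "\<And>w. integrable lborel (\<lambda>z. (cmod (g z))\<^sup>2 * exp (- (cmod (z - w))\<^sup>2))"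
    and bound: "\<And>w. (LINT z|lborel. (cmod (g z))\<^sup>2 * exp (- (cmod (z - w))\<^sup>2)) \<le> M"
  shows "\<exists>c. \<forall>z. g z = c"
proof -
  have [measurable]: "g \<in> borel_measurable borel"
    using g by (rule holomorphic_measurable)
  have [measurable]: "ball (0::complex) 1 \<in> sets borel" by simp
  have "cmod (g w) \<le> (pi + exp 1 * M) / pi" for w
  proof -
    let ?k = "\<lambda>z. (cmod (g z))\<^sup>2 * exp (- (cmod (z - w))\<^sup>2)"
    have k: "integrable lborel (\<lambda>z. ?k (1 * z + w))"
      by (subst integrable_lborel_rigid) (use int in simp_all)
    have ik: "(LINT z|lborel. ?k (1 * z + w)) = (LINT z|lborel. ?k z)"
      by (rule integral_lborel_rigid) simp_all
    have ind: "integrable lborel (indicator (ball (0::complex) 1) :: complex \<Rightarrow> real)"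
      by (simp add: emeasure_ball)
    have le: "norm (indicator (ball 0 1) z *\<^sub>R g (w + z)) \<le> indicator (ball 0 1) z + exp 1 * ?k (1 * z + w)"
      for z
    proof (cases "z \<in> ball 0 1")
      case True
      then have "(cmod z)\<^sup>2 \<le> 1"
        by (simp add: power_le_one)
      then have "1 \<le> exp 1 * exp (- (cmod z)\<^sup>2)"
        by (simp flip: exp_add)
      then have "(cmod (g (w + z)))\<^sup>2 * 1 \<le> (cmod (g (w + z)))\<^sup>2 * (exp 1 * exp (- (cmod z)\<^sup>2))"
        by (rule mult_left_mono) simp
      moreover have "cmod (g (w + z)) \<le> 1 + (cmod (g (w + z)))\<^sup>2"
        using sum_squares_bound[of 1 "cmod (g (w + z))"] norm_ge_zero[of "g (w + z)"] 
        by (simp only: power_one mult_1_right)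
      ultimately show ?thesis
        using True by (simp add: add.commute mult_ac)
    qed simp
    have int1: "integrable lborel (\<lambda>z. indicator (ball 0 1) z *\<^sub>R g (w + z))"
    proof (rule Bochner_Integration.integrable_bound)
      show "integrable lborel (\<lambda>z. indicator (ball 0 1) z + exp 1 * ?k (1 * z + w))"
        by (intro Bochner_Integration.integrable_add integrable_mult_right ind k)
      show "AE z in lborel. norm (indicator (ball 0 1) z *\<^sub>R g (w + z)) \<le>
          norm (indicator (ball 0 1) z + exp 1 * ?k (1 * z + w))"
        using le by (intro AE_I2 order_trans[OF le]) simp
    qed measurable
    have "pi * cmod (g w) = norm (LINT z|lborel. indicator (ball 0 1) z *\<^sub>R g (w + z))"
      by (simp add: mean_value_disc[OF g] norm_mult)
    also have "\<dots> \<le> (LINT z|lborel. norm (indicator (ball 0 1) z *\<^sub>R g (w + z)))"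
      by (rule integral_norm_bound)
    also have "\<dots> \<le> (LINT z|lborel. indicator (ball 0 1) z + exp 1 * ?k (1 * z + w))"
      by (intro integral_mono le integrable_norm[OF int1] Bochner_Integration.integrable_add
          integrable_mult_right ind k)
    also have "\<dots> = (LINT z|lborel. indicator (ball (0::complex) 1) z) + exp 1 * (LINT z|lborel. ?k (1 * z + w))"
      by (simp only: Bochner_Integration.integral_add[OF ind integrable_mult_right[OF k]]
          integral_mult_right_zero)
    also have "\<dots> \<le> pi + exp 1 * M"
      unfolding ik using bound[of w] by (simp add: content_ball unit_ball_vol_2)
    finally show ?thesis
      by (simp add: field_simps)
  qed
  then have "bounded (range g)"
    unfolding bounded_iff by blast
  from Liouville_theorem[OF g this] show ?thesis
    by (auto simp: constant_on_def)
qed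

text \<open>Testing boundedness on the kernel functions \<open>exp (cnj u * z)\<close> with \<open>u = a w + b\<close>.\<close>
lemma bounded_weighted_comp_symbol:
  assumes \<psi>: "\<psi> holomorphic_on UNIV" and a: "cmod a = 1"
    and bdd: "fock_bounded (weighted_comp \<psi> (\<lambda>z. a * z + b))"
  shows "\<psi> z = \<psi> 0 * exp (- (a * cnj b * z))"
proof -
  define g where "g z = \<psi> z * exp (a * cnj b * z)" for z
  have g: "g holomorphic_on UNIV"
    unfolding g_def by (intro holomorphic_intros \<psi>)
  note [measurable] = \<psi>[THEN holomorphic_measurable] g[THEN holomorphic_measurable]
  let ?T = "weighted_comp \<psi> (\<lambda>z. a * z + b)"
  obtain K where K: "\<And>f. f \<in> fock_space \<Longrightarrow> fock_norm (?T f) \<le> K * fock_norm f"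
    using bdd by (auto simp: fock_bounded_def)
  let ?n = "fock_norm (\<lambda>_. 1)"
  \<comment> \<open>Chosen so that \<open>?c * M\<close> below is K^2 times the squared norm of the
    kernel function: exp (|u|^2) occurs on both sides and cancels, which makes \<open>M\<close>
    independent of \<open>w\<close>.\<close>
  define M where "M = pi * K\<^sup>2 * ?n\<^sup>2 * exp (- (cmod b)\<^sup>2)"
  have main: "integrable lborel (\<lambda>z. (cmod (g z))\<^sup>2 * exp (- (cmod (z - w))\<^sup>2)) \<and>
      (LINT z|lborel. (cmod (g z))\<^sup>2 * exp (- (cmod (z - w))\<^sup>2)) \<le> M" for w
  proof -
    \<comment> \<open>With this \<open>u\<close> the Gaussian weight, the factor between \<psi> and
      \<open>g\<close>, and the kernel at \<open>a * z + b\<close> complete the square to a Gaussian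
      centred at \<open>w\<close>.\<close>
    define u where "u = a * w + b"
    let ?k = "\<lambda>z. exp (cnj u * z)"
    let ?c = "exp ((cmod b)\<^sup>2 + (cmod u)\<^sup>2) / pi"
    let ?G = "\<lambda>z. (cmod (g z))\<^sup>2 * exp (- (cmod (z - w))\<^sup>2)"
    have k: "?k \<in> fock_space" "fock_norm ?k = exp ((cmod u)\<^sup>2 / 2) * ?n"
      using fock_space_coherent[OF fock_const_1, of u] by simp_all
    have Tk: "?T ?k \<in> fock_space"
      using bdd k by (simp add: fock_bounded_def)
    have dens: "(exp (- (cmod z)\<^sup>2) / pi) *\<^sub>R (cmod (?T ?k z))\<^sup>2 = ?c * ?G z" for z
    proof -
      have eq1: "(cmod (\<psi> z))\<^sup>2 = (cmod (g z))\<^sup>2 * exp (- 2 * Re (a * cnj b * z))"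
      proof -
        have "\<psi> z = g z * exp (- (a * cnj b * z))"
          by (simp add: g_def flip: exp_add)
        then show ?thesis
          by (simp only: norm_mult power_mult_distrib norm_exp_eq_Re) (simp flip: exp_double)
      qed
      have eq2: "(cmod (?k (a * z + b)))\<^sup>2 = exp (2 * Re (cnj u * (a * z + b)))"
        by (simp only: norm_exp_eq_Re exp_double)
      have eq3: "- (cmod z)\<^sup>2 + - 2 * Re (a * cnj b * z) + 2 * Re (cnj u * (a * z + b))
          = ((cmod b)\<^sup>2 + (cmod u)\<^sup>2) + - (cmod (z - w))\<^sup>2"
      proof -
        have "(cmod (z - w))\<^sup>2 = (cmod (a * (z - w)))\<^sup>2"
          using a by (simp add: norm_mult)
        also have "a * (z - w) = (a * z + b) - u"
          by (simp add: u_def algebra_simps)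
        also have "(cmod ((a * z + b) - u))\<^sup>2 =
            (cmod (a * z + b))\<^sup>2 - 2 * Re (cnj u * (a * z + b)) + (cmod u)\<^sup>2"
          unfolding cmod_power2 by (simp add: power2_eq_square algebra_simps)
        finally show ?thesis
          unfolding cmod_rigid_square[OF a] by simp
      qed
      have "exp A / pi * ((r * exp B) * exp C) = r * exp (A + B + C) / pi" for A B C r :: real
        by (simp add: exp_add)
      then have "exp (- (cmod z)\<^sup>2) / pi * ((cmod (\<psi> z))\<^sup>2 * (cmod (?k (a * z + b)))\<^sup>2) =
          (cmod (g z))\<^sup>2 * exp (((cmod b)\<^sup>2 + (cmod u)\<^sup>2) + - (cmod (z - w))\<^sup>2) / pi"
        unfolding eq1 eq2 eq3[symmetric] by blast
      also have "\<dots> = ?c * ?G z"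
        by (simp only: exp_add[of "_ + _" "- _"] times_divide_eq_left times_divide_eq_right mult_ac)
      finally show ?thesis
        by (simp only: weighted_comp_def norm_mult power_mult_distrib real_scaleR_def)
    qed
    have [measurable]: "(\<lambda>z. (cmod (?T ?k z))\<^sup>2) \<in> borel_measurable borel"
      using fock_space_measurable[OF Tk] by measurable
    have "integrable lborel (\<lambda>z. ?c * ?G z)"
      using fock_space_integrable[OF Tk] unfolding dens[symmetric]
      by (rule integrable_fock_measure[THEN iffD1, rotated]) measurable
    then have "integrable lborel (\<lambda>z. inverse ?c * (?c * ?G z))"
      by (rule integrable_mult_right)
    then have i: "integrable lborel ?G"
      by (simp only: mult.assoc[symmetric]) simp
    have "?c * (LINT z|lborel. ?G z) = (LINT z|lborel. ?c * ?G z)"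
      by simp
    also have "\<dots> = (fock_norm (?T ?k))\<^sup>2"
      unfolding dens[symmetric] fock_norm_square
      by (rule integral_fock_measure[symmetric]) measurable
    also have "\<dots> \<le> (K * fock_norm ?k)\<^sup>2"
      using K[OF k(1)] by (intro power_mono fock_norm_nonneg)
    also have "\<dots> = K\<^sup>2 * ?n\<^sup>2 * exp ((cmod u)\<^sup>2)"
      by (simp add: k(2) power_mult_distrib flip: exp_double)
    also have "\<dots> = ?c * M"
      by (simp add: M_def field_simps flip: exp_add)
    finally have "(LINT z|lborel. ?G z) \<le> M"
      by (rule mult_left_le_imp_le) simp
    with i show ?thesis by blast
  qed
  obtain c where c: "\<And>z. g z = c"
    using entire_constant_of_local_L2_bound[OF g, of M] main by blast
  have "\<psi> z = g z * exp (- (a * cnj b * z))"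
    by (simp add: g_def flip: exp_add)
  also have "g z = g 0"
    by (simp add: c)
  finally show ?thesis
    by (simp add: g_def)
qed

section \<open>Scaling, discs, and the convex hull of the powers of \<open>a\<close>\<close>

lemma numerical_range_cmult:
  assumes "\<And>f. T f = (\<lambda>z. x * V f z)"
  shows "numerical_range T = (\<lambda>s. x * s) ` numerical_range V"
  unfolding numerical_range_def assms fock_inner_scale_left by auto

text \<open>Each \<open>p\<close> lies on a diameter, with endpoints \<open>r * e\<close> and
  \<open>- r * e\<close> on the circle; \<open>t\<close> is its position there, and
  \<open>e = 1\<close> serves for p = 0.\<close>

lemma convex_contains_cball:
  fixes S :: "complex set"
  assumes "convex S" "sphere 0 r \<subseteq> S" "0 \<le> r"
  shows "cball 0 r \<subseteq> S"
proof
  fix p :: complex assume p: "p \<in> cball 0 r"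
  have "cmod (sgn p) = 1 \<and> p = of_real (cmod p) * sgn p" if "p \<noteq> 0"
    using that by (simp only: norm_sgn) (simp add: sgn_eq)
  then obtain e where e: "cmod e = 1" "p = of_real (cmod p) * e"
    by (cases "p = 0") (auto intro: that[of 1])
  show "p \<in> S"
  proof (cases "r = 0")
    case True
    then show ?thesis using p assms(2) by auto
  next
    case False
    define t where "t = (1 + cmod p / r) / 2"
    have "of_real r * e \<in> S" "- (of_real r * e) \<in> S"
      using assms e by (auto simp: norm_mult subset_eq)
    moreover have "0 \<le> t" "t \<le> 1"
      using assms p False by (auto simp: t_def field_simps)
    ultimately have "(1 - t) *\<^sub>R (- (of_real r * e)) + t *\<^sub>R (of_real r * e) \<in> S"
      using assms(1) by (intro convexD_alt)
    also have "(1 - t) *\<^sub>R (- (of_real r * e)) + t *\<^sub>R (of_real r * e) = of_real ((2 * t - 1) * r) * e"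
      by (simp add: scaleR_conv_of_real algebra_simps)
    also have "(2 * t - 1) * r = cmod p"
      using False by (simp add: t_def field_simps)
    finally show ?thesis using e(2) by simp
  qed
qed

text \<open>Kronecker's theorem in one dimension: the angle of \<open>a\<close> is 2 pi \<theta>
  with \<theta> irrational, since \<theta> = p / q would give \<open>a ^ q = 1\<close>. Fractional
  parts of k \<theta> approximate the angle of \<open>x\<close>, and \<open>cis\<close> is
  continuous.\<close>

lemma powers_dense_in_circle:
  assumes a: "cmod a = 1" "\<not> root_of_unity a" and x: "cmod x = 1"
  shows "x \<in> closure {a ^ m | m :: nat. True}"
proof -
  define \<theta> where "\<theta> = Arg2pi a / (2 * pi)"
  have power_a: "a ^ k = cis (2 * pi * (real k * \<theta>))" for k
  proof -
    have "a = cis (2 * pi * \<theta>)"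
      using complex_norm_eq_1_exp[of a] a(1) by (simp add: \<theta>_def cis_conv_exp)
    then show ?thesis
      by (simp only: Complex.DeMoivre mult.left_commute)
  qed
  have irr: "\<theta> \<notin> \<rat>"
  proof
    assume "\<theta> \<in> \<rat>"
    then obtain p :: int and q :: nat where q: "q \<noteq> 0" "\<theta> = of_int p / of_nat q"
      unfolding Rats_eq_int_div_nat by auto
    have "a ^ q = cis (2 * pi * of_int p)"
      unfolding power_a using q by simp
    then have "a ^ q = 1"
      by (simp add: cis_multiple_2pi)
    moreover have "0 < q" using q(1) by simp
    ultimately show False
      using a(2) unfolding root_of_unity_def by blast
  qed
  define \<alpha> where "\<alpha> = Arg2pi x / (2 * pi)"
  have \<alpha>: "0 \<le> \<alpha>" "\<alpha> \<le> 1"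
    using Arg2pi_ge_0[of x] Arg2pi_lt_2pi[of x] by (simp_all add: \<alpha>_def field_simps)
  have x_cis: "x = cis (2 * pi * \<alpha>)"
    using complex_norm_eq_1_exp[of x] x by (simp add: \<alpha>_def cis_conv_exp)
  have "isCont (\<lambda>t. cis (2 * pi * t)) \<alpha>"
    unfolding cis_conv_exp by (intro continuous_intros)
  show ?thesis
    unfolding closure_approachable
  proof (intro allI impI)
    fix e :: real assume "0 < e"
    with \<open>isCont (\<lambda>t. cis (2 * pi * t)) \<alpha>\<close> obtain d where d: "d > 0"
        "\<And>t. dist t \<alpha> < d \<Longrightarrow> dist (cis (2 * pi * t)) (cis (2 * pi * \<alpha>)) < e"
      unfolding continuous_at_eps_delta by blast
    obtain k where k: "\<bar>frac (real k * \<theta>) - \<alpha>\<bar> < d"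
      using Kronecker_approx_1_explicit[OF irr \<alpha> d(1)] by blast
    have "cis (2 * pi * frac (real k * \<theta>)) = cis (2 * pi * (real k * \<theta>)) * cis (2 * pi * - of_int \<lfloor>real k * \<theta>\<rfloor>)"
      by (simp add: frac_def cis_mult algebra_simps)
    also have "cis (2 * pi * - of_int \<lfloor>real k * \<theta>\<rfloor>) = 1"
      using cis_multiple_2pi[of "of_int (- \<lfloor>real k * \<theta>\<rfloor>)"] by (simp del: of_int_floor_cancel)
    finally have "a ^ k = cis (2 * pi * frac (real k * \<theta>))"
      by (simp add: power_a)
    with d(2)[of "frac (real k * \<theta>)"] k have "dist (a ^ k) x < e"
      by (simp add: dist_real_def x_cis)
    then show "\<exists>y\<in>{a ^ m |m. True}. dist y x < e"
      by (intro bexI[of _ "a ^ k"]) auto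
  qed
qed

text \<open>Density puts the closed disc only into the closure of the hull, but a convex set has the
  same interior as its closure.\<close>

lemma ball_subset_hull_powers:
  assumes "cmod a = 1" "\<not> root_of_unity a"
  shows "ball 0 1 \<subseteq> convex hull {a ^ m | m :: nat. True}"
proof -
  let ?H = "convex hull {a ^ m | m :: nat. True}"
  have "sphere 0 1 \<subseteq> closure {a ^ m | m :: nat. True}"
    using powers_dense_in_circle[OF assms] by auto
  also have "\<dots> \<subseteq> closure ?H"
    by (intro closure_mono hull_subset)
  finally have "cball 0 1 \<subseteq> closure ?H"
    by (intro convex_contains_cball convex_closure convex_convex_hull) auto
  then have "interior (cball 0 1) \<subseteq> interior (closure ?H)"
    by (rule interior_mono)
  also have "\<dots> = interior ?H"
    by (intro convex_interior_closure convex_convex_hull)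
  also have "\<dots> \<subseteq> ?H"
    by (rule interior_subset)
  finally show ?thesis by simp
qed

section \<open>Rotations and translations\<close>

text \<open>Some Taylor coefficient of \<open>g\<close> at 0 is nonzero; comparing the derivatives
  of that order on both sides yields \<open>x = a ^ m\<close>.\<close>

lemma eigenvalue_of_rotation:
  assumes g: "g holomorphic_on UNIV" and eq: "\<And>u. g (a * u) = x * g u" and nz: "g w \<noteq> 0"
  shows "\<exists>m::nat. x = a ^ m"
proof -
  obtain m where m: "(deriv ^^ m) g 0 \<noteq> 0"
    using holomorphic_fun_eq_0_on_connected[OF g open_UNIV connected_UNIV, of 0 w] nz by blast
  have "x * (deriv ^^ m) g 0 = (deriv ^^ m) (\<lambda>u. x * g u) 0"
    by (rule higher_deriv_cmult[OF g, symmetric]) simp_all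
  also have "\<dots> = (deriv ^^ m) (\<lambda>u. g (a * u)) 0"
    by (simp add: eq)
  also have "\<dots> = a ^ m * (deriv ^^ m) g (a * 0)"
    by (rule higher_deriv_compose_linear[OF g, of UNIV]) simp_all
  finally show ?thesis using m by auto
qed

text \<open>The rotation about the fixed point \<open>c = b / (1 - a)\<close>, conjugated by the shift to \<open>c\<close>.\<close>
definition fock_rotation :: "complex \<Rightarrow> complex \<Rightarrow> (complex \<Rightarrow> complex) \<Rightarrow> complex \<Rightarrow> complex" where
  "fock_rotation a c f = (\<lambda>z. exp (cnj c * (z - (a * (z - c) + c))) * f (a * (z - c) + c))"

text \<open>Substituting b = c (1 - a) gives a |b|^2 / (a - 1) = |c|^2 (1 - a), whose real part
  |c|^2 (1 - Re a) equals |b|^2 / 2. Hence the two lifts of the same motion differ by a mere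
  phase.\<close>

lemma fock_rotation_weyl:
  fixes a b :: complex
  assumes a: "cmod a = 1" "a \<noteq> 1"
  defines "c \<equiv> b / (1 - a)"
  shows "fock_rotation a c f = (\<lambda>z. exp (of_real ((cmod b)\<^sup>2 / 2) - a * of_real ((cmod b)\<^sup>2) / (a - 1)) * weyl a b f z)"
    and "cmod (exp (of_real ((cmod b)\<^sup>2 / 2) - a * of_real ((cmod b)\<^sup>2) / (a - 1))) = 1"
proof -
  have b: "b = c * (1 - a)"
    using a by (simp add: c_def)
  have aa: "a * cnj a = 1"
    using a(1) by (simp flip: complex_norm_square)
  have fix_c: "a * (z - c) + c = a * z + b" for z
    by (simp add: b algebra_simps)
  have bb: "of_real ((cmod b)\<^sup>2) = c * (1 - a) * (cnj c * (1 - cnj a))"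
    by (simp only: complex_norm_square) (simp add: b)
  have "a * (1 - cnj a) = a - 1"
    using aa by (simp add: algebra_simps)
  then have "a * of_real ((cmod b)\<^sup>2) = (a - 1) * (c * (1 - a) * cnj c)"
    unfolding bb by (metis (no_types) mult.assoc mult.commute)
  then have e: "a * of_real ((cmod b)\<^sup>2) / (a - 1) = c * (1 - a) * cnj c"
    using a(2) by simp
  have ab: "a * cnj b = cnj c * (a - 1)"
    using aa by (simp add: b algebra_simps)
  have "- (a * cnj b * z) = cnj c * (1 - a) * z" for z
    unfolding ab by (simp add: algebra_simps)
  then have "(of_real ((cmod b)\<^sup>2 / 2) - a * of_real ((cmod b)\<^sup>2) / (a - 1)) +
      (- (a * cnj b * z) - of_real ((cmod b)\<^sup>2 / 2)) = cnj c * (z - (a * z + b))" for z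
    unfolding e by (simp add: b algebra_simps)
  then have *: "exp (of_real ((cmod b)\<^sup>2 / 2) - a * of_real ((cmod b)\<^sup>2) / (a - 1)) *
      exp (- (a * cnj b * z) - of_real ((cmod b)\<^sup>2 / 2)) = exp (cnj c * (z - (a * z + b)))" for z
    by (simp only: flip: exp_add)
  show "fock_rotation a c f = (\<lambda>z. exp (of_real ((cmod b)\<^sup>2 / 2) - a * of_real ((cmod b)\<^sup>2) / (a - 1)) * weyl a b f z)"
    unfolding fock_rotation_def weyl_def fix_c by (simp only: mult.assoc[symmetric] *)
  have "of_real ((cmod b)\<^sup>2) = c * cnj c * (2 - (a + cnj a))"
    unfolding bb using aa by (simp add: algebra_simps)
  also have "\<dots> = c * cnj c * of_real (2 - 2 * Re a)"
    by (simp add: complex_add_cnj)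
  also have "c * cnj c = of_real ((cmod c)\<^sup>2)"
    by (simp only: complex_norm_square)
  finally have "(cmod b)\<^sup>2 = (cmod c)\<^sup>2 * (2 - 2 * Re a)"
    by (simp only: flip: of_real_mult) (simp only: of_real_eq_iff)
  moreover have "Re (c * (1 - a) * cnj c) = (cmod c)\<^sup>2 * (1 - Re a)"
  proof -
    have *: "c * (1 - a) * cnj c = of_real ((cmod c)\<^sup>2) * (1 - a)"
      by (simp only: complex_norm_square) (simp only: mult_ac)
    show ?thesis unfolding * by simp
  qed
  ultimately show "cmod (exp (of_real ((cmod b)\<^sup>2 / 2) - a * of_real ((cmod b)\<^sup>2) / (a - 1))) = 1"
    unfolding e norm_exp_eq_Re by simp
qed

lemma fock_rotation_isometry:
  assumes a: "cmod a = 1" "a \<noteq> 1"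
  shows "fock_isometry (fock_rotation a c)"
proof -
  define b where "b = c * (1 - a)"
  have c: "c = b / (1 - a)"
    using a by (simp add: b_def)
  define x where "x = exp (of_real ((cmod b)\<^sup>2 / 2) - a * of_real ((cmod b)\<^sup>2) / (a - 1))"
  have rot: "fock_rotation a c f = (\<lambda>z. x * weyl a b f z)" for f
    unfolding c x_def by (rule fock_rotation_weyl(1)[OF a])
  have "cmod x = 1"
    unfolding x_def by (rule fock_rotation_weyl(2)[OF a])
  then have x: "x * cnj x = 1"
    by (simp flip: complex_norm_square)
  note W = weyl_isometry[OF a(1), of b]
  have "fock_linear (fock_rotation a c)"
    using fock_isometry_linear[OF W] unfolding fock_linear_def rot
    by (auto simp: fock_space_scale algebra_simps)
  moreover have "fock_inner (fock_rotation a c f) (fock_rotation a c g) = fock_inner f g"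
    if "f \<in> fock_space" "g \<in> fock_space" for f g
  proof -
    have "fock_inner (fock_rotation a c f) (fock_rotation a c g) =
        (x * cnj x) * fock_inner (weyl a b f) (weyl a b g)"
      unfolding rot fock_inner_scale_left fock_inner_scale_right by (simp only: mult.assoc)
    then show ?thesis using that a by (simp add: x weyl_inner)
  qed
  ultimately show ?thesis
    by (simp add: fock_isometry_def)
qed

lemma fock_rotation_eigenvalues:
  assumes a: "cmod a = 1" "a \<noteq> 1"
  shows "a ^ m \<in> numerical_range (fock_rotation a c)"
proof -
  let ?f = "\<lambda>z. (z - c) ^ m * exp (cnj c * z)"
  have f: "?f \<in> fock_space"
    using fock_space_coherent(1)[OF monomial_fock_space] .
  have "?f (c + 1) \<noteq> 0" by simp
  with f have "fock_norm ?f \<noteq> 0"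
    by (rule fock_norm_neq_0)
  moreover have "fock_rotation a c ?f = (\<lambda>z. a ^ m * ?f z)"
  proof
    fix z
    define p where "p = a * (z - c) + c"
    have "exp (cnj c * (z - p)) * exp (cnj c * p) = exp (cnj c * z)"
      by (simp add: algebra_simps flip: exp_add)
    moreover have "p - c = a * (z - c)"
      by (simp add: p_def)
    ultimately show "fock_rotation a c ?f z = a ^ m * ?f z"
      unfolding fock_rotation_def p_def[symmetric] by (simp add: power_mult_distrib mult_ac)
  qed
  ultimately show ?thesis
    by (intro numerical_range_eigenvalue[OF f _ fock_isometry_linear[OF fock_rotation_isometry[OF a]]])
qed

text \<open>Moving the fixed point to 0 and dividing by the kernel factor turns the eigenvector
  equation into \<open>g (a * u) = x * g u\<close>.\<close>

lemma fock_rotation_eigenvalueD: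
  assumes f: "f holomorphic_on UNIV" and eq: "fock_rotation a c f = (\<lambda>z. x * f z)" and nz: "f w \<noteq> 0"
  shows "\<exists>m::nat. x = a ^ m"
proof (rule eigenvalue_of_rotation)
  let ?g = "\<lambda>u. exp (- (cnj c * u)) * f (u + c)"
  have "(\<lambda>u. f (u + c)) holomorphic_on UNIV"
    by (rule holomorphic_on_compose_gen[OF _ f, unfolded o_def]) (auto intro!: holomorphic_intros)
  then show "?g holomorphic_on UNIV"
    by (intro holomorphic_intros)
  show "?g (w - c) \<noteq> 0"
    using nz by simp
  fix u
  have "exp (cnj c * (u - a * u)) * f (a * u + c) = x * f (u + c)"
    using fun_cong[OF eq, of "u + c"] by (simp add: fock_rotation_def)
  then have "exp (- (cnj c * u)) * (exp (cnj c * (u - a * u)) * f (a * u + c)) =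
      exp (- (cnj c * u)) * (x * f (u + c))"
    by (rule arg_cong)
  then have "(exp (- (cnj c * u)) * exp (cnj c * (u - a * u))) * f (a * u + c) = x * ?g u"
    by (simp only: mult_ac)
  moreover have "exp (- (cnj c * u)) * exp (cnj c * (u - a * u)) = exp (- (cnj c * (a * u)))"
    by (simp add: algebra_simps flip: exp_add)
  ultimately show "?g (a * u) = x * ?g u"
    by simp
qed

text \<open>The exponents telescope, so the \<open>j\<close>-th power is the rotation for
  \<open>a ^ j\<close> without an extra phase; for \<open>a ^ n = 1\<close> it is the identity.
  Powers of \<open>weyl a b\<close> may pick up a phase, hence this normalisation.\<close>

lemma fock_rotation_power:
  "(fock_rotation a c ^^ j) f = (\<lambda>z. exp (cnj c * (z - (a ^ j * (z - c) + c))) * f (a ^ j * (z - c) + c))"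
proof (induction j)
  case (Suc j)
  show ?case
  proof
    fix z
    define p where "p = a * (z - c) + c"
    define q where "q = a ^ j * (p - c) + c"
    have "(fock_rotation a c ^^ Suc j) f z = exp (cnj c * (z - p)) * (exp (cnj c * (p - q)) * f q)"
      by (simp add: Suc fock_rotation_def p_def q_def)
    also have "\<dots> = exp (cnj c * (z - q)) * f q"
      by (simp add: algebra_simps flip: exp_add mult.assoc)
    also have "q = a ^ Suc j * (z - c) + c"
      by (simp add: q_def p_def mult_ac)
    finally show "(fock_rotation a c ^^ Suc j) f z =
        exp (cnj c * (z - (a ^ Suc j * (z - c) + c))) * f (a ^ Suc j * (z - c) + c)" .
  qed
qed simp

lemma numerical_range_rotation_cyclic:
  assumes a: "cmod a = 1" "a \<noteq> 1" "primitive_root_of_unity n a"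
  shows "numerical_range (fock_rotation a c) = root_polygon n a"
proof
  note iso = fock_rotation_isometry[OF a(1,2), of c]
  have "a ^ n = 1"
    using a(3) by (simp add: primitive_root_of_unity_def)
  then show "numerical_range (fock_rotation a c) \<subseteq> root_polygon n a"
    by (intro numerical_range_cyclic[OF iso a(3)]) (simp add: fock_rotation_power)
  show "root_polygon n a \<subseteq> numerical_range (fock_rotation a c)"
    unfolding root_polygon_def
    by (rule hull_minimal)
       (use fock_rotation_eigenvalues[OF a(1,2)] convex_numerical_range[OF fock_isometry_linear[OF iso]] in auto)
qed

lemma numerical_range_rotation_irrational:
  assumes a: "cmod a = 1" "\<not> root_of_unity a"
  shows "numerical_range (fock_rotation a c) = ball 0 1 \<union> {a ^ m | m :: nat. True}"
proof
  have a1: "a \<noteq> 1"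
    using a(2) by (auto simp: root_of_unity_def)
  note iso = fock_rotation_isometry[OF a(1) a1, of c]
  have powers: "{a ^ m | m :: nat. True} \<subseteq> numerical_range (fock_rotation a c)"
    using fock_rotation_eigenvalues[OF a(1) a1] by auto
  moreover from this have "convex hull {a ^ m | m :: nat. True} \<subseteq> numerical_range (fock_rotation a c)"
    by (rule hull_minimal[where S=convex]) (rule convex_numerical_range[OF fock_isometry_linear[OF iso]])
  ultimately show "ball 0 1 \<union> {a ^ m | m :: nat. True} \<subseteq> numerical_range (fock_rotation a c)"
    using ball_subset_hull_powers[OF a] by blast
  show "numerical_range (fock_rotation a c) \<subseteq> ball 0 1 \<union> {a ^ m | m :: nat. True}"
  proof
    fix v assume "v \<in> numerical_range (fock_rotation a c)"
    then obtain f where f: "f \<in> fock_space" "fock_norm f = 1" and v: "v = fock_inner (fock_rotation a c f) f"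
      by (auto simp: numerical_range_def)
    show "v \<in> ball 0 1 \<union> {a ^ m | m :: nat. True}"
    proof (cases "cmod v = 1")
      case True
      then have "fock_rotation a c f = (\<lambda>z. v * f z)"
        using fock_isometry_inner_eq[OF iso f] by (simp add: v)
      moreover have "f \<noteq> (\<lambda>_. 0)"
        using f(2) by (auto simp: fock_norm_def fock_inner_def)
      then obtain w where "f w \<noteq> 0"
        by auto
      ultimately show ?thesis
        using fock_rotation_eigenvalueD[OF fock_space_holomorphic[OF f(1)]] by blast
    next
      case False
      then show ?thesis
        using fock_isometry_inner_le[OF iso f] by (simp add: v)
    qed
  qed
qed

text \<open>The density \<open>|f|^2 exp (-|z|^2)\<close> of an eigenvector would be integrable and \<open>b\<close>-periodic;
  the half planes \<open>{r \<le> h}\<close> and \<open>{r + 1 \<le> h}\<close> then carry the same mass, so every strip is null.\<close>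
lemma weyl_no_eigenvector:
  assumes b: "b \<noteq> 0" and f: "f \<in> fock_space" "fock_norm f = 1" and x: "cmod x = 1"
  shows "weyl 1 b f \<noteq> (\<lambda>z. x * f z)"
proof
  assume eq: "weyl 1 b f = (\<lambda>z. x * f z)"
  note [measurable] = f(1)[THEN fock_space_measurable]
  define G where "G z = (exp (- (cmod z)\<^sup>2) / pi) *\<^sub>R (f z * cnj (f z))" for z
  have [measurable]: "G \<in> borel_measurable borel"
    unfolding G_def by measurable
  have "x * cnj x = 1"
    using x by (simp flip: complex_norm_square)
  then have "weyl 1 b f z * cnj (weyl 1 b f z) = f z * cnj (f z)" for z
    unfolding eq by (simp add: mult_ac)
  then have G_periodic: "G (1 * z + b) = G z" for z
    using weyl_density[of 1 z b f f] by (simp only: G_def norm_one simp_thms)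
  have G_int: "integrable lborel G"
    using fock_inner_integrable[OF f(1) f(1)] unfolding G_def
    by (subst (asm) integrable_fock_measure) measurable
  \<comment> \<open>The coordinate along \<open>b\<close>, scaled so that translation by
    \<open>b\<close> raises it by 1.\<close>
  define h where "h z = Re (cnj b * z) / (cmod b)\<^sup>2" for z
  have [measurable]: "h \<in> borel_measurable borel"
    unfolding h_def by (intro borel_measurable_continuous_onI continuous_intros) (use b in auto)
  have "Re (cnj b * b) = (cmod b)\<^sup>2"
    by (simp add: cmod_power2, simp add: power2_eq_square)
  then have h_shift: "h (1 * z + b) = h z + 1" for z
    using b by (simp add: h_def distrib_left add_divide_distrib)
  let ?I = "\<lambda>r z. indicator {z. r \<le> h z} z *\<^sub>R G z"
  have I_int: "integrable lborel (?I r)" for r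
    by (intro integrable_mult_indicator G_int) measurable
  have strip: "AE z in lborel. r \<le> h z \<longrightarrow> h z < r + 1 \<longrightarrow> f z = 0" for r
  proof -
    have "(LINT z|lborel. ?I (r + 1) z) = (LINT z|lborel. ?I (r + 1) (1 * z + b))"
      by (rule integral_lborel_rigid[symmetric]) simp_all
    also have "\<dots> = (LINT z|lborel. ?I r z)"
      by (intro Bochner_Integration.integral_cong refl) (simp add: G_periodic[simplified] h_shift[simplified] indicator_def)
    finally have "(LINT z|lborel. ?I r z - ?I (r + 1) z) = 0"
      using I_int by simp
    moreover have "?I r z - ?I (r + 1) z =
        of_real (indicator {z. r \<le> h z \<and> h z < r + 1} z * (exp (- (cmod z)\<^sup>2) / pi * (cmod (f z))\<^sup>2))" for z
      by (simp only: G_def flip: complex_norm_square) (simp add: indicator_def scaleR_conv_of_real)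
    moreover note Bochner_Integration.integrable_diff[OF I_int I_int, of r "r + 1"]
    ultimately have "(LINT z|lborel. indicator {z. r \<le> h z \<and> h z < r + 1} z * (exp (- (cmod z)\<^sup>2) / pi * (cmod (f z))\<^sup>2)) = 0"
      "integrable lborel (\<lambda>z. indicator {z. r \<le> h z \<and> h z < r + 1} z * (exp (- (cmod z)\<^sup>2) / pi * (cmod (f z))\<^sup>2))"
      by (simp_all only: integral_complex_of_real complex_of_real_integrable_eq of_real_eq_0_iff)
    then have "AE z in lborel. indicator {z. r \<le> h z \<and> h z < r + 1} z * (exp (- (cmod z)\<^sup>2) / pi * (cmod (f z))\<^sup>2) = 0"
      by (subst (asm) integral_nonneg_eq_0_iff_AE) auto
    then show ?thesis
      by (rule AE_mp) (auto simp: indicator_def)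
  qed
  have "AE z in lborel. \<forall>k::int. of_int k \<le> h z \<longrightarrow> h z < of_int k + 1 \<longrightarrow> f z = 0"
    using strip by (simp add: AE_all_countable)
  then have "AE z in lborel. f z = 0"
  proof eventually_elim
    case (elim z)
    then show ?case
      using of_int_floor_le[of "h z"] real_of_int_floor_add_one_gt[of "h z"] by blast
  qed
  then have "AE z in fock_measure. (cmod (f z))\<^sup>2 = 0"
    unfolding fock_measure_def by (subst AE_density) auto
  then have "(fock_norm f)\<^sup>2 = 0"
    unfolding fock_norm_square by (rule integral_eq_zero_AE)
  with f(2) show False by simp
qed

text \<open>The Weyl commutation relation: \<open>weyl 1 b\<close> and \<open>weyl 1 c\<close>
  commute up to the phase \<open>exp (cnj b * c - cnj c * b)\<close>. Passing from \<open>f\<close>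
  to the unit vector \<open>weyl 1 c f\<close> therefore multiplies the value by that phase.\<close>

lemma numerical_range_weyl_circular:
  assumes b: "b \<noteq> 0" and s: "s \<in> numerical_range (weyl 1 b)" and x: "cmod x = 1"
  shows "x * s \<in> numerical_range (weyl 1 b)"
proof -
  obtain f where f: "f \<in> fock_space" "fock_norm f = 1" and s: "s = fock_inner (weyl 1 b f) f"
    using s by (auto simp: numerical_range_def)
  \<comment> \<open>A real multiple of \<i> * b makes \<open>cnj b * c - cnj c * b\<close> purely
    imaginary; the multiple is fixed so that it equals \<i> times the argument of
    \<open>x\<close>.\<close>
  define c where "c = \<i> * of_real (Arg2pi x / (2 * (cmod b)\<^sup>2)) * b"
  have "cnj b * c - cnj c * b = 2 * \<i> * of_real (Arg2pi x / (2 * (cmod b)\<^sup>2)) * (b * cnj b)"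
    by (simp add: c_def)
  also have "b * cnj b = of_real ((cmod b)\<^sup>2)"
    by (simp only: complex_norm_square)
  also have "2 * \<i> * of_real (Arg2pi x / (2 * (cmod b)\<^sup>2)) * of_real ((cmod b)\<^sup>2) = \<i> * of_real (Arg2pi x)"
    using b by simp
  finally have phase: "exp (cnj b * c - cnj c * b) = x"
    using x complex_norm_eq_1_exp[of x] by simp
  have "weyl 1 b (weyl 1 c f) = (\<lambda>z. x * weyl 1 c (weyl 1 b f) z)"
  proof
    fix z
    have "exp (cnj b * c - cnj c * b) * (exp (- (cnj c * z) - B) * exp (- (cnj b * (z + c)) - A))
        = exp (- (cnj b * z) - A) * exp (- (cnj c * (z + b)) - B)" for A B
      by (simp add: algebra_simps flip: exp_add)
    then show "weyl 1 b (weyl 1 c f) z = x * weyl 1 c (weyl 1 b f) z"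
      unfolding phase weyl_def by (simp add: add_ac flip: mult.assoc)
  qed
  then have "fock_inner (weyl 1 b (weyl 1 c f)) (weyl 1 c f) = x * s"
    using f by (simp add: fock_inner_scale_left weyl_inner weyl_fock_space s)
  moreover have "fock_inner (weyl 1 b (weyl 1 c f)) (weyl 1 c f) \<in> numerical_range (weyl 1 b)"
    using f by (intro numerical_range_memI) (simp_all add: weyl_fock_space weyl_norm)
  ultimately show ?thesis by simp
qed

lemma numerical_range_weyl:
  assumes b: "b \<noteq> 0"
  shows "numerical_range (weyl 1 b) = ball 0 1"
proof
  have iso: "fock_isometry (weyl 1 b)"
    by (rule weyl_isometry) simp
  show "numerical_range (weyl 1 b) \<subseteq> ball 0 1"
  proof
    fix v assume "v \<in> numerical_range (weyl 1 b)"
    then obtain f where f: "f \<in> fock_space" "fock_norm f = 1" and v: "v = fock_inner (weyl 1 b f) f"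
      by (auto simp: numerical_range_def)
    have "cmod v \<noteq> 1"
      using fock_isometry_inner_eq[OF iso f] weyl_no_eigenvector[OF b f, of v] by (auto simp: v)
    then show "v \<in> ball 0 1"
      using fock_isometry_inner_le[OF iso f] by (simp add: v)
  qed
  show "ball 0 1 \<subseteq> numerical_range (weyl 1 b)"
  proof
    fix v :: complex assume "v \<in> ball 0 1"
    then have "cmod v < 1" by simp
    then obtain s where s: "s \<in> numerical_range (weyl 1 b)" "cmod v < cmod s"
      using fock_isometry_numerical_radius[OF iso] fock_unit_vector_exists by blast
    have "sphere (0::complex) (cmod s) \<subseteq> numerical_range (weyl 1 b)"
    proof
      fix p :: complex assume "p \<in> sphere 0 (cmod s)"
      moreover have "s \<noteq> 0" using s(2) by auto
      ultimately have "cmod (p / s) = 1" "p = p / s * s"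
        by (simp_all add: norm_divide)
      then show "p \<in> numerical_range (weyl 1 b)"
        using numerical_range_weyl_circular[OF b s(1)] by metis
    qed
    then have "cball 0 (cmod s) \<subseteq> numerical_range (weyl 1 b)"
      by (intro convex_contains_cball convex_numerical_range fock_isometry_linear iso) simp_all
    then show "v \<in> numerical_range (weyl 1 b)"
      using s(2) by auto
  qed
qed

section \<open>Back to weighted composition operators\<close>

lemma weighted_comp_weyl:
  assumes "\<And>z. \<psi> z = \<psi> 0 * exp (- (a * cnj b * z))"
  shows "weighted_comp \<psi> (\<lambda>z. a * z + b) f = (\<lambda>z. \<psi> 0 * of_real (exp ((cmod b)\<^sup>2 / 2)) * weyl a b f z)"
proof
  fix z
  have "of_real (exp ((cmod b)\<^sup>2 / 2)) * exp (- (a * cnj b * z) - of_real ((cmod b)\<^sup>2 / 2)) =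
      exp (of_real ((cmod b)\<^sup>2 / 2) + (- (a * cnj b * z) - of_real ((cmod b)\<^sup>2 / 2)))"
    by (simp only: exp_of_real exp_add)
  also have "\<dots> = exp (- (a * cnj b * z))"
    by simp
  finally show "weighted_comp \<psi> (\<lambda>z. a * z + b) f z = \<psi> 0 * of_real (exp ((cmod b)\<^sup>2 / 2)) * weyl a b f z"
    unfolding weighted_comp_def weyl_def by (subst assms) (simp only: mult.assoc[symmetric], simp only: mult.assoc)
qed

lemma weighted_comp_rotation:
  assumes \<psi>: "\<And>z. \<psi> z = \<psi> 0 * exp (- (a * cnj b * z))" and a: "cmod a = 1" "a \<noteq> 1"
  shows "weighted_comp \<psi> (\<lambda>z. a * z + b) f =
    (\<lambda>z. \<psi> 0 * exp (a * of_real ((cmod b)\<^sup>2) / (a - 1)) * fock_rotation a (b / (1 - a)) f z)"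
proof
  fix z
  have "exp (a * of_real ((cmod b)\<^sup>2) / (a - 1)) *
      exp (of_real ((cmod b)\<^sup>2 / 2) - a * of_real ((cmod b)\<^sup>2) / (a - 1)) = of_real (exp ((cmod b)\<^sup>2 / 2))"
    by (simp only: exp_of_real[symmetric] flip: exp_add) simp
  then show "weighted_comp \<psi> (\<lambda>z. a * z + b) f z =
      \<psi> 0 * exp (a * of_real ((cmod b)\<^sup>2) / (a - 1)) * fock_rotation a (b / (1 - a)) f z"
    unfolding weighted_comp_weyl[OF \<psi>] fock_rotation_weyl(1)[OF a] by (metis mult.assoc)
qed

text \<open>For a = 1 and b = 0 the operator is multiplication by the number
  \<open>\<psi> 0\<close>, whose numerical range is one point and not a disc of positive radius. The
  last conjunct therefore asks for \<open>b \<noteq> 0 \<or> \<psi> 0 = 0\<close>; when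
  \<open>\<psi> 0 = 0\<close>, both sides are {0}.\<close>

theorem theorem3p1:
  fixes \<psi> \<phi> :: "complex \<Rightarrow> complex" and a b :: complex
  assumes "\<psi> holomorphic_on UNIV"
    and "\<phi> = (\<lambda>z. a * z + b)"
    and "cmod a = 1"
    and "fock_bounded (weighted_comp \<psi> \<phi>)"
  shows "(\<forall>n. a \<noteq> 1 \<and> primitive_root_of_unity n a \<longrightarrow>
            numerical_range (weighted_comp \<psi> \<phi>) =
              (\<lambda>s. \<psi> 0 * exp (a * of_real ((cmod b)\<^sup>2) / (a - 1)) * s) ` root_polygon n a)
       \<and> (\<not> root_of_unity a \<longrightarrow>
            numerical_range (weighted_comp \<psi> \<phi>) =
              (\<lambda>s. \<psi> 0 * exp (a * of_real ((cmod b)\<^sup>2) / (a - 1)) * s) ` ball 0 1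
              \<union> {\<psi> 0 * exp (a * of_real ((cmod b)\<^sup>2) / (a - 1)) * a ^ m | m :: nat. m \<ge> 0})
       \<and> (a = 1 \<and> (b \<noteq> 0 \<or> \<psi> 0 = 0) \<longrightarrow>
            numerical_range (weighted_comp \<psi> \<phi>) =
              (\<lambda>s. \<psi> 0 * of_real (exp ((cmod b)\<^sup>2 / 2)) * s) ` ball 0 1)"
proof -
  note a = assms(3)
  have \<psi>: "\<psi> z = \<psi> 0 * exp (- (a * cnj b * z))" for z
    using assms(4) unfolding assms(2) by (rule bounded_weighted_comp_symbol[OF assms(1) a])
  let ?\<gamma> = "\<psi> 0 * exp (a * of_real ((cmod b)\<^sup>2) / (a - 1))"
  have rotation: "numerical_range (weighted_comp \<psi> \<phi>) =
      (\<lambda>s. ?\<gamma> * s) ` numerical_range (fock_rotation a (b / (1 - a)))" if "a \<noteq> 1"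
    unfolding assms(2) by (intro numerical_range_cmult weighted_comp_rotation \<psi> a that)
  have translation: "numerical_range (weighted_comp \<psi> \<phi>) =
      (\<lambda>s. \<psi> 0 * of_real (exp ((cmod b)\<^sup>2 / 2)) * s) ` numerical_range (weyl a b)"
    unfolding assms(2) by (intro numerical_range_cmult weighted_comp_weyl \<psi>)
  show ?thesis
  proof (intro conjI allI impI; (elim conjE)?)
    fix n assume an: "a \<noteq> 1" "primitive_root_of_unity n a"
    show "numerical_range (weighted_comp \<psi> \<phi>) = (\<lambda>s. ?\<gamma> * s) ` root_polygon n a"
      unfolding rotation[OF an(1)] numerical_range_rotation_cyclic[OF a an] ..
  next
    assume ra: "\<not> root_of_unity a"
    then have "a \<noteq> 1" by (auto simp: root_of_unity_def)
    then show "numerical_range (weighted_comp \<psi> \<phi>) =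
        (\<lambda>s. ?\<gamma> * s) ` ball 0 1 \<union> {?\<gamma> * a ^ m | m :: nat. m \<ge> 0}"
      unfolding rotation[OF \<open>a \<noteq> 1\<close>] numerical_range_rotation_irrational[OF a ra] image_Un by blast
  next
    assume "a = 1" and b: "b \<noteq> 0 \<or> \<psi> 0 = 0"
    show "numerical_range (weighted_comp \<psi> \<phi>) =
        (\<lambda>s. \<psi> 0 * of_real (exp ((cmod b)\<^sup>2 / 2)) * s) ` ball 0 1"
    proof (cases "b = 0")
      case False
      show ?thesis
        unfolding translation \<open>a = 1\<close> numerical_range_weyl[OF False] ..
    next
      case True
      with b have "\<psi> 0 = 0" by simp
      moreover have "numerical_range (weyl a b) \<noteq> {}"
        using fock_unit_vector_exists numerical_range_memI by blast
      ultimately show ?thesis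
        unfolding translation by (simp add: image_constant_conv)
    qed
  qed
qed

end
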